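(* Let $K$ be a field of characteristic zero, let $\mathfrak{M}$ be an arbitrary variety of algebras over $K$, and let $A=K_{\mathfrak{M}}\langle x_1,\ldots,x_n\rangle$ be the free algebra of $\mathfrak{M}$ on $x_1,\ldots,x_n$. If the tangent algebra $T(\mathrm{Aut}(A))$ is generated modulo $L_{-1}+L_0$ (i.e. generated as a Lie algebra by $L_{-1}+L_0$ together with the listed elements) by all derivations of the form $f\partial_1$, where $f\in K_{\mathfrak{M}}\langle x_2,\ldots,x_n\rangle$ is homogeneous of degree $\ge2$, then every automorphism of $A$ is approximately tame.
   Context: Algebras are vector spaces over $K$ with a bilinear multiplication. If $\mathfrak{M}$ is a unitary variety, $A$ is taken to have an identity element $1$. Grading: $A=A_0\oplus A_1\oplus\cdots$, $A_k$ the linear span of monomials of degree $k$; $A_0=K\cdot1$ if $A$ is unital and $A_0=0$ otherwise. $f_1\partial_1+\cdots+f_n\partial_n$ is the unique derivation of $A$ with $x_i\mapsto f_i$. $L=\mathrm{Der}(A)=L_{-1}\oplus L_0\oplus L_1\oplus\cdots$, where $L_i$ consists of all $f_1\partial_1+\cdots+f_n\partial_n$ with all $f_j\in A_{i+1}$ ($L_{-1}=0$ if $A$ is not unital). For $k\ge1$, $\mathrm{IA}(k)$ is the group of automorphisms $\phi$ of $A$ with $\phi(x_j)-x_j\in A_{k+1}+A_{k+2}+\cdots$ for all $j$. If $\phi\in\mathrm{IA}(i)\setminus\mathrm{IA}(i+1)$ and $\phi(x_j)=x_j+f_j+F_j$ with $f_j\in A_{i+1}$, $F_j\in A_{i+2}+A_{i+3}+\cdots$,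 then $T(\phi)=f_1\partial_1+\cdots+f_n\partial_n\in L_i$. For a subgroup $H$ of $\mathrm{Aut}(A)$ containing all affine automorphisms (if $A$ is unital) or all linear automorphisms (if not), put $H_i=H\cap\mathrm{IA}(i)$, $V_i(H)=\{0\}\cup\{T(\phi)\mid\phi\in H_i\setminus H_{i+1}\}$ for $i\ge1$; the tangent algebra is $T(H)=L_{-1}\oplus L_0\oplus V_1(H)\oplus V_2(H)\oplus\cdots$, a graded Lie subalgebra of $\mathrm{Der}(A)$. An automorphism $(x_1,\ldots,x_{i-1},\alpha x_i+f,x_{i+1},\ldots,x_n)$ with $0\ne\alpha\in K$ and $f$ in the subalgebra generated by the $x_j$, $j\ne i$, is called elementary; tame automorphisms are the elements of the subgroup of $\mathrm{Aut}(A)$ generated by elementary automorphisms. $\phi\in\mathrm{Aut}(A)$ is approximately tame if there is a sequence of tame automorphisms $\psi_k$ with $\phi\psi_k^{-1}\in\mathrm{IA}(k)$ for all $k$. *)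

theory Defs
  imports Complex_Main
begin

text \<open>
  Algebras over a field are not assumed to be associative. The additive group of an algebra is the
  one of the type \<open>'a\<close>; \<open>unt\<close> is \<open>Some e\<close> if the algebra is considered with an identity element
  \<open>e\<close> as part of the signature, and \<open>None\<close> otherwise.
\<close>

record ('k, 'a) nalg =
  scl :: "'k \<Rightarrow> 'a \<Rightarrow> 'a"
  mul :: "'a \<Rightarrow> 'a \<Rightarrow> 'a"
  unt :: "'a option"

definition is_algebra :: "('k::field_char_0, 'a::ab_group_add) nalg \<Rightarrow> bool" where
  "is_algebra A \<longleftrightarrow>
     vector_space (scl A) \<and>
     (\<forall>b. Vector_Spaces.linear (scl A) (scl A) (\<lambda>a. mul A a b)) \<and>
     (\<forall>a. Vector_Spaces.linear (scl A) (scl A) (\<lambda>b. mul A a b)) \<and>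
     (\<forall>e. unt A = Some e \<longrightarrow> (\<forall>a. mul A e a = a \<and> mul A a e = a))"

definition is_hom ::
  "('k::field_char_0, 'a::ab_group_add) nalg \<Rightarrow> ('k, 'b::ab_group_add) nalg \<Rightarrow> ('a \<Rightarrow> 'b) \<Rightarrow> bool" where
  "is_hom A B h \<longleftrightarrow>
     Vector_Spaces.linear (scl A) (scl B) h \<and>
     (\<forall>a b. h (mul A a b) = mul B (h a) (h b)) \<and>
     (\<forall>e. unt A = Some e \<longrightarrow> unt B = Some (h e))"

definition Aut :: "('k::field_char_0, 'a::ab_group_add) nalg \<Rightarrow> ('a \<Rightarrow> 'a) set" where
  "Aut A = {\<phi>. is_hom A A \<phi> \<and> bij \<phi>}"

inductive_set subalg :: "('k::field_char_0, 'a::ab_group_add) nalg \<Rightarrow> 'a set \<Rightarrow> 'a set"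
  for A :: "('k::field_char_0, 'a::ab_group_add) nalg" and S :: "'a set" where
  gen: "a \<in> S \<Longrightarrow> a \<in> subalg A S"
| unit: "unt A = Some e \<Longrightarrow> e \<in> subalg A S"
| zero: "0 \<in> subalg A S"
| add: "a \<in> subalg A S \<Longrightarrow> b \<in> subalg A S \<Longrightarrow> a + b \<in> subalg A S"
| scale: "a \<in> subalg A S \<Longrightarrow> scl A c a \<in> subalg A S"
| mult: "a \<in> subalg A S \<Longrightarrow> b \<in> subalg A S \<Longrightarrow> mul A a b \<in> subalg A S"


subsection \<open>Varieties and their free algebras\<close>

text \<open>
  Nonassociative polynomials are represented by terms; a term \<open>t\<close> stands for the identity \<open>t = 0\<close>.
  A variety is given by a flag \<open>u\<close> (is it unitary?) and a set \<open>\<Sigma>\<close> of defining identities. Where there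
  is no identity element, the symbol \<open>Unit\<close> is read as \<open>0\<close>, so that it carries no information.
\<close>

datatype 'k nterm =
    Var nat
  | Unit
  | Zero
  | Add "'k nterm" "'k nterm"
  | Scale 'k "'k nterm"
  | Mul "'k nterm" "'k nterm"

primrec vars :: "'k nterm \<Rightarrow> nat set" where
  "vars (Var i) = {i}"
| "vars Unit = {}"
| "vars Zero = {}"
| "vars (Add s t) = vars s \<union> vars t"
| "vars (Scale c t) = vars t"
| "vars (Mul s t) = vars s \<union> vars t"

primrec eval :: "('k::field_char_0, 'a::ab_group_add) nalg \<Rightarrow> (nat \<Rightarrow> 'a) \<Rightarrow> 'k nterm \<Rightarrow> 'a" where
  "eval A v (Var i) = v i"
| "eval A v Unit = (case unt A of None \<Rightarrow> 0 | Some e \<Rightarrow> e)"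
| "eval A v Zero = 0"
| "eval A v (Add s t) = eval A v s + eval A v t"
| "eval A v (Scale c t) = scl A c (eval A v t)"
| "eval A v (Mul s t) = mul A (eval A v s) (eval A v t)"

primrec subst :: "(nat \<Rightarrow> 'k nterm) \<Rightarrow> 'k nterm \<Rightarrow> 'k nterm" where
  "subst \<sigma> (Var i) = \<sigma> i"
| "subst \<sigma> Unit = Unit"
| "subst \<sigma> Zero = Zero"
| "subst \<sigma> (Add s t) = Add (subst \<sigma> s) (subst \<sigma> t)"
| "subst \<sigma> (Scale c t) = Scale c (subst \<sigma> t)"
| "subst \<sigma> (Mul s t) = Mul (subst \<sigma> s) (subst \<sigma> t)"

definition variety ::
  "bool \<Rightarrow> 'k nterm set \<Rightarrow> ('k::field_char_0, 'a::ab_group_add) nalg set" where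
  "variety u \<Sigma> = {A. is_algebra A \<and> (u \<longleftrightarrow> unt A \<noteq> None) \<and> (\<forall>t\<in>\<Sigma>. \<forall>v. eval A v t = 0)}"

text \<open>
  \<open>equiv_in u \<Sigma> s t\<close>: the difference of \<open>s\<close> and \<open>t\<close> lies in the T-ideal of identities of the variety.
  The quotient of the terms by this congruence is the quotient of the absolutely free
  (nonassociative) algebra by the T-ideal generated by \<open>\<Sigma>\<close>.
\<close>

inductive equiv_in :: "bool \<Rightarrow> 'k::field_char_0 nterm set \<Rightarrow> 'k nterm \<Rightarrow> 'k nterm \<Rightarrow> bool"
  for u :: bool and \<Sigma> :: "'k nterm set" where
  refl: "equiv_in u \<Sigma> t t"
| sym: "equiv_in u \<Sigma> s t \<Longrightarrow> equiv_in u \<Sigma> t s"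
| trans: "equiv_in u \<Sigma> r s \<Longrightarrow> equiv_in u \<Sigma> s t \<Longrightarrow> equiv_in u \<Sigma> r t"
| cong_Add: "equiv_in u \<Sigma> s s' \<Longrightarrow> equiv_in u \<Sigma> t t' \<Longrightarrow> equiv_in u \<Sigma> (Add s t) (Add s' t')"
| cong_Scale: "equiv_in u \<Sigma> t t' \<Longrightarrow> equiv_in u \<Sigma> (Scale c t) (Scale c t')"
| cong_Mul: "equiv_in u \<Sigma> s s' \<Longrightarrow> equiv_in u \<Sigma> t t' \<Longrightarrow> equiv_in u \<Sigma> (Mul s t) (Mul s' t')"
| Add_assoc: "equiv_in u \<Sigma> (Add (Add r s) t) (Add r (Add s t))"
| Add_comm: "equiv_in u \<Sigma> (Add s t) (Add t s)"
| Add_Zero: "equiv_in u \<Sigma> (Add Zero t) t"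
| Scale_zero: "equiv_in u \<Sigma> (Scale 0 t) Zero"
| Scale_one: "equiv_in u \<Sigma> (Scale 1 t) t"
| Scale_Scale: "equiv_in u \<Sigma> (Scale c (Scale d t)) (Scale (c * d) t)"
| Scale_add: "equiv_in u \<Sigma> (Scale (c + d) t) (Add (Scale c t) (Scale d t))"
| Scale_Add: "equiv_in u \<Sigma> (Scale c (Add s t)) (Add (Scale c s) (Scale c t))"
| Mul_Add_left: "equiv_in u \<Sigma> (Mul (Add r s) t) (Add (Mul r t) (Mul s t))"
| Mul_Add_right: "equiv_in u \<Sigma> (Mul r (Add s t)) (Add (Mul r s) (Mul r t))"
| Mul_Scale_left: "equiv_in u \<Sigma> (Mul (Scale c s) t) (Scale c (Mul s t))"
| Mul_Scale_right: "equiv_in u \<Sigma> (Mul s (Scale c t)) (Scale c (Mul s t))"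
| Unit_left: "u \<Longrightarrow> equiv_in u \<Sigma> (Mul Unit t) t"
| Unit_right: "u \<Longrightarrow> equiv_in u \<Sigma> (Mul t Unit) t"
| no_Unit: "\<not> u \<Longrightarrow> equiv_in u \<Sigma> Unit Zero"
| identity: "t \<in> \<Sigma> \<Longrightarrow> equiv_in u \<Sigma> (subst \<sigma> t) Zero"

text \<open>
  \<open>A\<close> is the free algebra of the variety on \<open>x 1, \<dots>, x n\<close>: it lies in the variety, is generated by
  these elements, and they satisfy no relations but the identities of the variety. The usual
  universal property is derived below.
\<close>

definition free_on ::
  "bool \<Rightarrow> 'k nterm set \<Rightarrow> ('k::field_char_0, 'a::ab_group_add) nalg \<Rightarrow> nat \<Rightarrow> (nat \<Rightarrow> 'a) \<Rightarrow> bool" where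
  "free_on u \<Sigma> A n x \<longleftrightarrow>
     A \<in> variety u \<Sigma> \<and>
     subalg A (x ` {1..n}) = UNIV \<and>
     (\<forall>s t. vars s \<subseteq> {1..n} \<and> vars t \<subseteq> {1..n} \<and> eval A x s = eval A x t \<longrightarrow> equiv_in u \<Sigma> s t)"

lemma eval_subst: "eval A v (subst \<sigma> t) = eval A (\<lambda>i. eval A v (\<sigma> i)) t"
  by (induction t) auto

lemma equiv_in_sound:
  assumes "equiv_in u \<Sigma> s t" and "A \<in> variety u \<Sigma>"
  shows "eval A v s = eval A v t"
proof -
  have alg: "is_algebra A" and u: "u \<longleftrightarrow> unt A \<noteq> None"
    and ids: "\<And>t v. t \<in> \<Sigma> \<Longrightarrow> eval A v t = 0"
    using assms(2) by (auto simp: variety_def)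
  interpret vector_space "scl A" using alg by (simp add: is_algebra_def)
  have hom: "module_hom (scl A) (scl A) (\<lambda>a. mul A a b)" "module_hom (scl A) (scl A) (mul A a)" for a b
    using alg by (simp_all add: is_algebra_def module_hom_iff_linear)
  note bilin = module_hom.add[OF hom(1)] module_hom.add[OF hom(2)]
    module_hom.scale[OF hom(1)] module_hom.scale[OF hom(2)]
  have one: "mul A e a = a" "mul A a e = a" if "unt A = Some e" for a e
    using alg that by (auto simp: is_algebra_def)
  from assms(1) show ?thesis
    by induction
      (use u in \<open>auto simp: bilin one eval_subst ids add.assoc add.commute scale_left_distrib
        scale_right_distrib\<close>)
qed

lemma free_on_universal:
  fixes A :: "('k::field_char_0, 'a::ab_group_add) nalg" and B :: "('k, 'b::ab_group_add) nalg"
  assumes A: "free_on u \<Sigma> A n x" and B: "B \<in> variety u \<Sigma>"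
  shows "\<exists>h. is_hom A B h \<and> (\<forall>i\<in>{1..n}. h (x i) = b i)"
proof -
  have AV: "A \<in> variety u \<Sigma>" and gen: "subalg A (x ` {1..n}) = UNIV"
    using A by (auto simp: free_on_def)
  have term_ex: "\<exists>t. vars t \<subseteq> {1..n} \<and> eval A x t = a" for a
  proof -
    have "a \<in> subalg A (x ` {1..n})" using gen by simp
    then show ?thesis
    proof induction
      case (gen a)
      then obtain i where "i \<in> {1..n}" "a = x i" by auto
      then show ?case by (intro exI[of _ "Var i"]) simp
    next
      case (unit e)
      then show ?case by (intro exI[of _ Unit]) simp
    next
      case zero
      then show ?case by (intro exI[of _ Zero]) simp
    next
      case (add a b)
      then obtain s t where "vars s \<subseteq> {1..n}" "eval A x s = a" "vars t \<subseteq> {1..n}" "eval A x t = b"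
        by blast
      then show ?case by (intro exI[of _ "Add s t"]) simp
    next
      case (scale a c)
      then obtain s where "vars s \<subseteq> {1..n}" "eval A x s = a" by blast
      then show ?case by (intro exI[of _ "Scale c s"]) simp
    next
      case (mult a b)
      then obtain s t where "vars s \<subseteq> {1..n}" "eval A x s = a" "vars t \<subseteq> {1..n}" "eval A x t = b"
        by blast
      then show ?case by (intro exI[of _ "Mul s t"]) simp
    qed
  qed
  then obtain T where T: "\<And>a. vars (T a) \<subseteq> {1..n}" "\<And>a. eval A x (T a) = a" by metis
  define h where "h a = eval B b (T a)" for a
  have h: "h (eval A x t) = eval B b t" if "vars t \<subseteq> {1..n}" for t
  proof -
    have "equiv_in u \<Sigma> (T (eval A x t)) t"
      using A T that by (auto simp: free_on_def)
    then show ?thesis unfolding h_def by (rule equiv_in_sound[OF _ B])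
  qed
  have vs: "vector_space (scl A)" "vector_space (scl B)"
    and u: "u \<longleftrightarrow> unt A \<noteq> None" "u \<longleftrightarrow> unt B \<noteq> None"
    using AV B by (auto simp: variety_def is_algebra_def)
  have "h (a + a') = h a + h a'" for a a'
    using h[of "Add (T a) (T a')"] T by (simp add: h_def)
  moreover have "h (scl A c a) = scl B c (h a)" for c a
    using h[of "Scale c (T a)"] T by (simp add: h_def)
  moreover have "h (mul A a a') = mul B (h a) (h a')" for a a'
    using h[of "Mul (T a) (T a')"] T by (simp add: h_def)
  moreover have "unt B = Some (h e)" if "unt A = Some e" for e
    using h[of Unit] that u by auto
  moreover have "h (x i) = b i" if "i \<in> {1..n}" for i
    using h[of "Var i"] that by simp
  ultimately have "is_hom A B h \<and> (\<forall>i\<in>{1..n}. h (x i) = b i)"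
    using vs by (auto simp: is_hom_def linear_iff_module_hom module_hom_def module_hom_axioms_def
        module_iff_vector_space)
  then show ?thesis by blast
qed


subsection \<open>Grading and derivations\<close>

inductive_set monomials ::
  "('k::field_char_0, 'a::ab_group_add) nalg \<Rightarrow> nat \<Rightarrow> (nat \<Rightarrow> 'a) \<Rightarrow> (nat \<times> 'a) set"
  for A :: "('k::field_char_0, 'a::ab_group_add) nalg" and n :: nat and x :: "nat \<Rightarrow> 'a" where
  unit: "unt A = Some e \<Longrightarrow> (0, e) \<in> monomials A n x"
| gen: "i \<in> {1..n} \<Longrightarrow> (1, x i) \<in> monomials A n x"
| mult: "(j, a) \<in> monomials A n x \<Longrightarrow> (k, b) \<in> monomials A n x
    \<Longrightarrow> (j + k, mul A a b) \<in> monomials A n x"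

definition hcomp ::
  "('k::field_char_0, 'a::ab_group_add) nalg \<Rightarrow> nat \<Rightarrow> (nat \<Rightarrow> 'a) \<Rightarrow> nat \<Rightarrow> 'a set" where
  "hcomp A n x k = module.span (scl A) {m. (k, m) \<in> monomials A n x}"

definition tail ::
  "('k::field_char_0, 'a::ab_group_add) nalg \<Rightarrow> nat \<Rightarrow> (nat \<Rightarrow> 'a) \<Rightarrow> nat \<Rightarrow> 'a set" where
  "tail A n x k = module.span (scl A) (\<Union>m\<in>{k..}. hcomp A n x m)"

definition Der :: "('k::field_char_0, 'a::ab_group_add) nalg \<Rightarrow> ('a \<Rightarrow> 'a) set" where
  "Der A = {D. Vector_Spaces.linear (scl A) (scl A) D \<and>
               (\<forall>a b. D (mul A a b) = mul A (D a) b + mul A a (D b))}"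

text \<open>
  The derivation \<open>f\<^sub>1\<partial>\<^sub>1 + \<dots> + f\<^sub>n\<partial>\<^sub>n\<close>. It exists and is unique if \<open>A\<close> is free on the \<open>x\<close> (the field is
  infinite).
\<close>

definition vfield ::
  "('k::field_char_0, 'a::ab_group_add) nalg \<Rightarrow> nat \<Rightarrow> (nat \<Rightarrow> 'a) \<Rightarrow> (nat \<Rightarrow> 'a) \<Rightarrow> 'a \<Rightarrow> 'a" where
  "vfield A n x f = (THE D. D \<in> Der A \<and> (\<forall>j\<in>{1..n}. D (x j) = f j))"

text \<open>The component \<open>L\<^sub>i\<close> of \<open>Der A\<close>, for \<open>i \<ge> -1\<close>.\<close>

definition der_comp ::
  "('k::field_char_0, 'a::ab_group_add) nalg \<Rightarrow> nat \<Rightarrow> (nat \<Rightarrow> 'a) \<Rightarrow> int \<Rightarrow> ('a \<Rightarrow> 'a) set" where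
  "der_comp A n x i = {vfield A n x f | f. \<forall>j\<in>{1..n}. f j \<in> hcomp A n x (nat (i + 1))}"

inductive_set lie_gen ::
  "('k::field_char_0, 'a::ab_group_add) nalg \<Rightarrow> ('a \<Rightarrow> 'a) set \<Rightarrow> ('a \<Rightarrow> 'a) set"
  for A :: "('k::field_char_0, 'a::ab_group_add) nalg" and G :: "('a \<Rightarrow> 'a) set" where
  gen: "D \<in> G \<Longrightarrow> D \<in> lie_gen A G"
| zero: "(\<lambda>a. 0) \<in> lie_gen A G"
| add: "D \<in> lie_gen A G \<Longrightarrow> E \<in> lie_gen A G \<Longrightarrow> (\<lambda>a. D a + E a) \<in> lie_gen A G"
| scale: "D \<in> lie_gen A G \<Longrightarrow> (\<lambda>a. scl A c (D a)) \<in> lie_gen A G"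
| bracket: "D \<in> lie_gen A G \<Longrightarrow> E \<in> lie_gen A G \<Longrightarrow> (\<lambda>a. D (E a) - E (D a)) \<in> lie_gen A G"


subsection \<open>The tangent algebra\<close>

definition IA ::
  "('k::field_char_0, 'a::ab_group_add) nalg \<Rightarrow> nat \<Rightarrow> (nat \<Rightarrow> 'a) \<Rightarrow> nat \<Rightarrow> ('a \<Rightarrow> 'a) set" where
  "IA A n x k = {\<phi> \<in> Aut A. \<forall>j\<in>{1..n}. \<phi> (x j) - x j \<in> tail A n x (k + 1)}"

definition V ::
  "('k::field_char_0, 'a::ab_group_add) nalg \<Rightarrow> nat \<Rightarrow> (nat \<Rightarrow> 'a) \<Rightarrow> ('a \<Rightarrow> 'a) set \<Rightarrow> nat \<Rightarrow> ('a \<Rightarrow> 'a) set" where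
  "V A n x H i = {\<lambda>a. 0} \<union>
     {vfield A n x f | f \<phi> F.
        \<phi> \<in> H \<inter> IA A n x i - H \<inter> IA A n x (i + 1) \<and>
        (\<forall>j\<in>{1..n}. \<phi> (x j) = x j + f j + F j \<and>
           f j \<in> hcomp A n x (i + 1) \<and> F j \<in> tail A n x (i + 2))}"

definition tangent_algebra ::
  "('k::field_char_0, 'a::ab_group_add) nalg \<Rightarrow> nat \<Rightarrow> (nat \<Rightarrow> 'a) \<Rightarrow> ('a \<Rightarrow> 'a) set \<Rightarrow> ('a \<Rightarrow> 'a) set" where
  "tangent_algebra A n x H =
     {(\<lambda>a. P a + Q a + (\<Sum>i=1..m. D i a)) | P Q D m.
        P \<in> der_comp A n x (-1) \<and> Q \<in> der_comp A n x 0 \<and> (\<forall>i\<in>{1..m}. D i \<in> V A n x H i)}"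


subsection \<open>Tame automorphisms\<close>

definition elementary ::
  "('k::field_char_0, 'a::ab_group_add) nalg \<Rightarrow> nat \<Rightarrow> (nat \<Rightarrow> 'a) \<Rightarrow> ('a \<Rightarrow> 'a) set" where
  "elementary A n x =
     {\<phi> \<in> Aut A. \<exists>i\<in>{1..n}. \<exists>\<alpha> f. \<alpha> \<noteq> 0 \<and> f \<in> subalg A (x ` ({1..n} - {i})) \<and>
        \<phi> (x i) = scl A \<alpha> (x i) + f \<and> (\<forall>j\<in>{1..n} - {i}. \<phi> (x j) = x j)}"

inductive_set tame ::
  "('k::field_char_0, 'a::ab_group_add) nalg \<Rightarrow> nat \<Rightarrow> (nat \<Rightarrow> 'a) \<Rightarrow> ('a \<Rightarrow> 'a) set"
  for A :: "('k::field_char_0, 'a::ab_group_add) nalg" and n :: nat and x :: "nat \<Rightarrow> 'a" where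
  gen: "\<phi> \<in> elementary A n x \<Longrightarrow> \<phi> \<in> tame A n x"
| one: "id \<in> tame A n x"
| comp: "\<phi> \<in> tame A n x \<Longrightarrow> \<psi> \<in> tame A n x \<Longrightarrow> \<phi> \<circ> \<psi> \<in> tame A n x"
| inverse: "\<phi> \<in> tame A n x \<Longrightarrow> inv \<phi> \<in> tame A n x"

definition approximately_tame ::
  "('k::field_char_0, 'a::ab_group_add) nalg \<Rightarrow> nat \<Rightarrow> (nat \<Rightarrow> 'a) \<Rightarrow> ('a \<Rightarrow> 'a) \<Rightarrow> bool" where
  "approximately_tame A n x \<phi> \<longleftrightarrow>
     (\<exists>\<psi>. \<forall>k\<ge>1. \<psi> k \<in> tame A n x \<and> \<phi> \<circ> inv (\<psi> k) \<in> IA A n x k)"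

end

theory Submission
  imports Defs "HOL-Computational_Algebra.Polynomial"
begin

text \<open>
  All corrections are made on the right: for \<open>\<phi> \<in> Aut A\<close> and every \<open>k\<close> one finds a tame \<open>\<tau>\<close> with
  \<open>\<phi> \<circ> \<tau> \<in> IA(k)\<close>. Translations and Gaussian elimination give \<open>k = 1\<close>. If \<open>\<phi> \<in> IA(k)\<close> has leading
  part \<open>D\<close>, it suffices that \<open>-D\<close> is the leading part of a tame automorphism. The derivations
  with this property are closed under brackets of positive degree (group commutators) and under
  brackets with \<open>L\<^sub>0\<close> (derivatives of conjugations by \<open>x\<^sub>i \<mapsto> x\<^sub>i + t g\<close>), but there is no direct
  argument for \<open>L\<^sub>-\<^sub>1\<close>, since conjugation by translations leaves \<open>IA\<close>. However, the span of
  the \<open>f\<partial>\<^sub>1\<close> is stable under \<open>L\<^sub>-\<^sub>1\<close> up to \<open>L\<^sub>0\<close>, hence so is the closure of these generators under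
  brackets with \<open>L\<^sub>0\<close> and with each other. This closure, together with \<open>L\<^sub>-\<^sub>1 + L\<^sub>0\<close>, is therefore the
  whole algebra generated in the hypothesis.
\<close>

text \<open>Two formal substitutions carry the argument: x_i to t x_i yields the grading, and x_i to
  x_i + t f_i yields the derivations. Both need A[t] to lie in the variety, which holds because an
  identity over A[t] can be tested at all scalars t and the field is infinite. Tame automorphisms,
  on the other hand, exist only for actual scalars. So the bracket with an element of L_0 is
  extracted from finitely many values of a polynomial curve of conjugates. The obstacle is a
  possible bad parameter: x_i to x_i + t g is not invertible when 1 + t b = 0, with b the
  coefficient of x_i in g. Sampling along c, 2c, 4c, ... with a suitable c avoids it, and
  characteristic zero keeps the sample points distinct. Leading parts are handled as statements on
  linear operators, \<phi> = 1 + D + (higher order) on all of A. Products, conjugates and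
  commutators are then computed with operators, and generators matter only when such a statement is
  first established.\<close>

lemma linear_iff_add_scale:
  assumes "vector_space s1" "vector_space s2"
  shows "Vector_Spaces.linear s1 s2 f \<longleftrightarrow>
    (\<forall>a b. f (a + b) = f a + f b) \<and> (\<forall>c a. f (s1 c a) = s2 c (f a))"
  using assms
  by (auto simp: linear_iff_module_hom module_hom_def module_hom_axioms_def module_iff_vector_space)

section \<open>Linear algebra in one nonassociative algebra, and its polynomial extension\<close>

locale nonassoc_algebra =
  fixes A :: "('k::field_char_0, 'a::ab_group_add) nalg"
  assumes is_alg: "is_algebra A"
begin

abbreviation scale_A (infixr "\<cdot>" 75) where "c \<cdot> a \<equiv> scl A c a"
abbreviation mul_A (infixl "\<star>" 70) where "a \<star> b \<equiv> mul A a b"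

sublocale vs: vector_space "scl A"
  using is_alg by (simp add: is_algebra_def)

abbreviation lin :: "('a \<Rightarrow> 'a) \<Rightarrow> bool" where
  "lin \<equiv> Vector_Spaces.linear (scl A) (scl A)"

lemma lin_iff: "lin f \<longleftrightarrow> (\<forall>a b. f (a + b) = f a + f b) \<and> (\<forall>c a. f (c \<cdot> a) = c \<cdot> f a)"
  by (rule linear_iff_add_scale) (rule vs.vector_space_axioms)+

lemma linD:
  assumes "lin f"
  shows "f (a + b) = f a + f b" "f (c \<cdot> a) = c \<cdot> f a" "f 0 = 0" "f (- a) = - f a"
    "f (a - b) = f a - f b" "f (sum g I) = (\<Sum>i\<in>I. f (g i))"
proof -
  interpret f: Vector_Spaces.linear "scl A" "scl A" f by fact
  show "f (a + b) = f a + f b" "f (c \<cdot> a) = c \<cdot> f a" "f 0 = 0" "f (- a) = - f a"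
    "f (a - b) = f a - f b" "f (sum g I) = (\<Sum>i\<in>I. f (g i))"
    by (simp_all add: f.add f.scale f.neg f.diff f.sum)
qed

lemma mul_lin: "lin (\<lambda>a. a \<star> b)" "lin (\<lambda>b. a \<star> b)"
  using is_alg by (simp_all add: is_algebra_def)

lemmas mul_left = linD[OF mul_lin(1)]
lemmas mul_right = linD[OF mul_lin(2)]

lemma unit_mul: "unt A = Some e \<Longrightarrow> e \<star> a = a" "unt A = Some e \<Longrightarrow> a \<star> e = a"
  using is_alg by (auto simp: is_algebra_def)

text \<open>The points \<open>2\<^sup>l c\<close> form a set closed under doubling, so \<open>F(2t) - 2\<^sup>m F(t)\<close> eliminates the top
  coefficient.\<close>

lemma coeffs_of_values:
  assumes W0: "(\<lambda>j. 0) \<in> W"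
    and Wadd: "\<And>f g. f \<in> W \<Longrightarrow> g \<in> W \<Longrightarrow> (\<lambda>j. f j + g j) \<in> W"
    and Wscale: "\<And>c f. f \<in> W \<Longrightarrow> (\<lambda>j. c \<cdot> f j) \<in> W"
    and "c \<noteq> 0"
    and "\<And>l. (\<lambda>j. \<Sum>i\<le>m. ((2 ^ l * c) ^ i) \<cdot> v i j) \<in> W"
    and "i \<le> m"
  shows "v i \<in> W"
  using assms(5,6)
proof (induction m arbitrary: v i)
  case 0
  then show ?case using "0.prems"(1)[of 0] by simp
next
  case (Suc m)
  have *: "v i \<in> W" if "i \<le> m" for i
  proof -
    define v' where "v' i j = (2 ^ i - 2 ^ Suc m) \<cdot> v i j" for i j
    have "v' i \<in> W"
    proof (rule Suc.IH[OF _ that])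
      fix l
      have eq: "(\<Sum>i\<le>m. ((2 ^ l * c) ^ i) \<cdot> v' i j) =
        (\<Sum>i\<le>Suc m. ((2 ^ Suc l * c) ^ i) \<cdot> v i j) +
        (- (2 ^ Suc m)) \<cdot> (\<Sum>i\<le>Suc m. ((2 ^ l * c) ^ i) \<cdot> v i j)" for j
      proof -
        have "((2 ^ Suc l * c) ^ i) \<cdot> v i j + (- (2 ^ Suc m)) \<cdot> ((2 ^ l * c) ^ i) \<cdot> v i j =
            ((2 ^ l * c) ^ i) \<cdot> v' i j" for i
          by (simp add: v'_def power_mult_distrib algebra_simps flip: vs.scale_left_distrib vs.scale_minus_left)
        then have "(\<Sum>i\<le>Suc m. ((2 ^ Suc l * c) ^ i) \<cdot> v i j) +
          (- (2 ^ Suc m)) \<cdot> (\<Sum>i\<le>Suc m. ((2 ^ l * c) ^ i) \<cdot> v i j) =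
          (\<Sum>i\<le>Suc m. ((2 ^ l * c) ^ i) \<cdot> v' i j)"
          by (simp add: vs.scale_sum_right flip: sum.distrib del: sum.atMost_Suc)
        then show ?thesis by (simp add: v'_def)
      qed
      show "(\<lambda>j. \<Sum>i\<le>m. ((2 ^ l * c) ^ i) \<cdot> v' i j) \<in> W"
        unfolding eq by (intro Wadd Wscale Suc.prems)
    qed
    moreover have "(2::'k) ^ i - 2 ^ Suc m \<noteq> 0"
    proof -
      \<comment> \<open>Characteristic zero: distinct powers of 2 remain distinct in
        \<open>'k\<close>, so the factor introduced in \<open>v'\<close> can be divided out.\<close>
      have "(2::nat) ^ i \<noteq> 2 ^ Suc m" using that using power_inject_exp[of "2::nat" i "Suc m"] by simp
      then have "(of_nat (2 ^ i) :: 'k) \<noteq> of_nat (2 ^ Suc m)" by (simp only: of_nat_eq_iff not_False_eq_True)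
      then show ?thesis by simp
    qed
    ultimately show "v i \<in> W"
      using Wscale[of "v' i" "inverse (2 ^ i - 2 ^ Suc m)"] by (simp add: v'_def)
  qed
  have sumW: "(\<lambda>j. \<Sum>i\<in>I. ((2 ^ 0 * c) ^ i) \<cdot> v i j) \<in> W" if "finite I" "I \<subseteq> {..m}" for I
    using that by (induction I) (auto intro!: W0 Wadd Wscale *)
  have "(\<lambda>j. inverse (c ^ Suc m) \<cdot> ((\<Sum>i\<le>Suc m. ((2 ^ 0 * c) ^ i) \<cdot> v i j) +
      (- 1) \<cdot> (\<Sum>i\<le>m. ((2 ^ 0 * c) ^ i) \<cdot> v i j))) \<in> W"
    by (intro Wscale Wadd Suc.prems sumW) auto
  then have "v (Suc m) \<in> W" using \<open>c \<noteq> 0\<close> by (simp del: power_Suc)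
  with * Suc.prems(2) show ?case by (cases "i = Suc m") auto
qed

subsection \<open>Polynomials with coefficients in an algebra\<close>

definition ev :: "'k \<Rightarrow> 'a poly \<Rightarrow> 'a" where
  "ev c p = (\<Sum>i\<le>degree p. c ^ i \<cdot> coeff p i)"

definition psc :: "'k \<Rightarrow> 'a poly \<Rightarrow> 'a poly" where
  "psc c p = map_poly (scl A c) p"

definition pmul :: "'a poly \<Rightarrow> 'a poly \<Rightarrow> 'a poly" where
  "pmul p q = (\<Sum>i\<le>degree p. \<Sum>j\<le>degree q. monom (coeff p i \<star> coeff q j) (i + j))"

text \<open>This is A[t], the tensor product of A with K[t]. The additive group is that of
  \<open>'a poly\<close>; scalars and product come from the record, because multiplication in A is
  not a type class operation.\<close>

definition polyalg :: "('k, 'a poly) nalg" where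
  "polyalg = \<lparr>scl = psc, mul = pmul, unt = map_option (\<lambda>e. [:e:]) (unt A)\<rparr>"

lemma polyalg_simps [simp]: "scl polyalg = psc" "mul polyalg = pmul"
  "unt polyalg = map_option (\<lambda>e. [:e:]) (unt A)"
  by (simp_all add: polyalg_def)

lemma ev_eq_sum: "degree p \<le> m \<Longrightarrow> ev c p = (\<Sum>i\<le>m. c ^ i \<cdot> coeff p i)"
  unfolding ev_def by (rule sum.mono_neutral_left) (auto simp: coeff_eq_0)

lemma ev_add: "ev c (p + q) = ev c p + ev c q"
  by (simp add: ev_eq_sum[of _ "max (degree p) (degree q)"] degree_add_le
      vs.scale_right_distrib sum.distrib)

lemma coeff_psc [simp]: "coeff (psc c p) i = c \<cdot> coeff p i"
  by (simp add: psc_def coeff_map_poly)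

lemma ev_psc: "ev c (psc d p) = d \<cdot> ev c p"
proof -
  have "degree (psc d p) \<le> degree p"
    by (rule degree_le) (simp add: coeff_eq_0)
  then show ?thesis
    by (simp add: ev_eq_sum[of _ "degree p"] vs.scale_sum_right mult.commute)
qed

lemma ev_sum: "ev c (sum f I) = (\<Sum>i\<in>I. ev c (f i))"
  by (induction I rule: infinite_finite_induct) (simp_all add: ev_add, simp_all add: ev_def)

lemma ev_monom: "ev c (monom a k) = c ^ k \<cdot> a"
proof -
  have "ev c (monom a k) = (\<Sum>i\<le>k. c ^ i \<cdot> coeff (monom a k) i)"
    by (rule ev_eq_sum) (rule degree_monom_le)
  also have "\<dots> = (\<Sum>i\<in>{k}. c ^ i \<cdot> coeff (monom a k) i)"
    by (rule sum.mono_neutral_right) auto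
  finally show ?thesis by simp
qed

lemma ev_pCons: "ev c (pCons a p) = a + c \<cdot> ev c p"
proof -
  have "ev c (pCons a p) = (\<Sum>i\<le>Suc (degree p). c ^ i \<cdot> coeff (pCons a p) i)"
    by (rule ev_eq_sum) (rule degree_pCons_le)
  then show ?thesis
    by (simp add: sum.atMost_Suc_shift vs.scale_sum_right ev_def del: sum.atMost_Suc)
qed

lemma ev_pmul: "ev c (pmul p q) = ev c p \<star> ev c q"
  by (simp add: pmul_def ev_sum ev_monom)
     (subst sum.swap, simp add: ev_def mul_left mul_right vs.scale_sum_right power_add mult.commute)

lemma coeff_pmul: "coeff (pmul p q) k = (\<Sum>i\<le>k. coeff p i \<star> coeff q (k - i))"
proof -
  have "coeff (pmul p q) k =
      (\<Sum>i\<le>degree p. \<Sum>j\<le>degree q. if i + j = k then coeff p i \<star> coeff q j else 0)"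
    by (simp add: pmul_def coeff_sum)
  also have "\<dots> = (\<Sum>i\<le>degree p. if i \<le> k then coeff p i \<star> coeff q (k - i) else 0)"
  proof (rule sum.cong)
    fix i
    show "(\<Sum>j\<le>degree q. if i + j = k then coeff p i \<star> coeff q j else 0) =
        (if i \<le> k then coeff p i \<star> coeff q (k - i) else 0)"
    proof (cases "i \<le> k")
      case True
      then have "(i + j = k) = (j = k - i)" for j by auto
      then show ?thesis
        using True by (auto simp: coeff_eq_0 mul_right)
    next
      case False
      then show ?thesis by auto
    qed
  qed simp
  also have "\<dots> = (\<Sum>i\<le>max k (degree p). if i \<le> k then coeff p i \<star> coeff q (k - i) else 0)"
    by (rule sum.mono_neutral_left) (auto simp: coeff_eq_0 mul_left)
  also have "\<dots> = (\<Sum>i\<le>k. if i \<le> k then coeff p i \<star> coeff q (k - i) else 0)"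
    by (rule sum.mono_neutral_right) auto
  finally show ?thesis by simp
qed

lemma polyalg_vector_space: "vector_space psc"
  by unfold_locales (auto intro!: poly_eqI simp: vs.scale_right_distrib vs.scale_left_distrib)

lemma is_algebra_polyalg: "is_algebra polyalg"
proof -
  have "pmul (p + p') q = pmul p q + pmul p' q" "pmul q (p + p') = pmul q p + pmul q p'"
    "pmul (psc c p) q = psc c (pmul p q)" "pmul q (psc c p) = psc c (pmul q p)" for c p p' q
    by (auto intro!: poly_eqI simp: coeff_pmul mul_left mul_right sum.distrib vs.scale_sum_right)
  moreover have "pmul [:e:] p = p \<and> pmul p [:e:] = p" if "unt A = Some e" for e p
  proof -
    have "coeff (pmul [:e:] p) k = (\<Sum>i\<in>{0}. coeff [:e:] i \<star> coeff p (k - i))"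
      "coeff (pmul p [:e:]) k = (\<Sum>i\<in>{k}. coeff p i \<star> coeff [:e:] (k - i))" for k
      unfolding coeff_pmul
      by (rule sum.mono_neutral_right; auto simp: coeff_pCons mul_left mul_right split: nat.splits)+
    then show ?thesis using that by (auto intro!: poly_eqI simp: unit_mul)
  qed
  ultimately show ?thesis
    unfolding is_algebra_def
    by (auto simp: linear_iff_add_scale polyalg_vector_space)
qed

lemma is_hom_iff:
  "is_hom A A h \<longleftrightarrow> lin h \<and> (\<forall>a b. h (a \<star> b) = h a \<star> h b) \<and> (\<forall>e. unt A = Some e \<longrightarrow> h e = e)"
  by (auto simp: is_hom_def)

lemma is_hom_ev: "is_hom polyalg A (ev c)"
  unfolding is_hom_def
  by (auto simp: linear_iff_add_scale polyalg_vector_space vs.vector_space_axioms ev_add ev_psc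
      ev_pmul ev_pCons) (simp_all add: ev_def)

lemma eval_hom:
  assumes "is_hom polyalg A h"
  shows "h (eval polyalg v t) = eval A (\<lambda>i. h (v i)) t"
proof -
  have "h (p + q) = h p + h q" "h (psc c p) = c \<cdot> h p" "h (pmul p q) = h p \<star> h q" for c p q
    using assms by (auto simp: is_hom_def linear_iff_add_scale polyalg_vector_space
        vs.vector_space_axioms)
  moreover have "h 0 = 0" using \<open>\<And>p q. h (p + q) = h p + h q\<close>[of 0 0] by simp
  moreover have "h [:e:] = e" if "unt A = Some e" for e
    using assms that by (auto simp: is_hom_def)
  ultimately show ?thesis
    by (induction t) (auto split: option.splits)
qed

lemma poly_zero_of_values:
  assumes "\<And>c. ev c p = 0" shows "p = 0"
proof (rule poly_eqI)
  fix i
  \<comment> \<open>The zero subspace plays the role of \<open>W\<close>, over a one-point index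
    set.\<close>
  have "(\<lambda>j::unit. coeff p i) \<in> {\<lambda>j. 0}" if "i \<le> degree p"
    by (rule coeffs_of_values[where c = 1 and m = "degree p" and v = "\<lambda>i j. coeff p i"])
      (use assms that in \<open>auto simp: ev_def\<close>)
  then show "coeff p i = coeff 0 i"
    by (cases "i \<le> degree p") (auto simp: coeff_eq_0 fun_eq_iff)
qed

text \<open>Evaluation at a scalar is a homomorphism onto A, so the value of an identity in A[t]
  vanishes at every scalar, and a polynomial with only zero values is zero. This is the step behind
  the homogeneity of T-ideals over an infinite field.\<close>

lemma polyalg_in_variety:
  assumes "A \<in> variety u \<Sigma>"
  shows "polyalg \<in> variety u \<Sigma>"
proof -
  have "eval polyalg v t = 0" if "t \<in> \<Sigma>" for t v
    by (rule poly_zero_of_values) (use assms that in \<open>auto simp: variety_def eval_hom[OF is_hom_ev]\<close>)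
  then show ?thesis
    using assms by (auto simp: variety_def is_algebra_polyalg)
qed

end

section \<open>Free algebras of a variety: existence and uniqueness of homomorphisms\<close>

locale free_algebra =
  fixes u :: bool and \<Sigma> :: "'k::field_char_0 nterm set"
    and A :: "('k, 'a::ab_group_add) nalg" and n :: nat and x :: "nat \<Rightarrow> 'a"
  assumes free: "free_on u \<Sigma> A n x"
begin

sublocale nonassoc_algebra A
  using free by unfold_locales (simp add: free_on_def variety_def)

lemma generated [case_names gen unit zero add scale mult]:
  assumes "\<And>i. i \<in> {1..n} \<Longrightarrow> P (x i)" "\<And>e. unt A = Some e \<Longrightarrow> P e" "P 0"
    "\<And>a b. P a \<Longrightarrow> P b \<Longrightarrow> P (a + b)" "\<And>c a. P a \<Longrightarrow> P (c \<cdot> a)"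
    "\<And>a b. P a \<Longrightarrow> P b \<Longrightarrow> P (a \<star> b)"
  shows "P a"
proof -
  have "a \<in> subalg A (x ` {1..n})" using free by (simp add: free_on_def)
  then show ?thesis by induction (use assms in auto)
qed

lemma ex_hom: "\<exists>h. is_hom A A h \<and> (\<forall>i\<in>{1..n}. h (x i) = b i)"
  using free_on_universal[OF free, of A b] free by (simp add: free_on_def)

lemma ex_poly_hom: "\<exists>h. is_hom A polyalg h \<and> (\<forall>i\<in>{1..n}. h (x i) = p i)"
  using free_on_universal[OF free polyalg_in_variety] free by (simp add: free_on_def)

lemma homD:
  assumes "is_hom A A h"
  shows "lin h" "h (a \<star> b) = h a \<star> h b" "unt A = Some e \<Longrightarrow> h e = e"
  using assms by (auto simp: is_hom_iff)

lemma poly_homD: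
  assumes "is_hom A polyalg h"
  shows "h (a + b) = h a + h b" "h (c \<cdot> a) = psc c (h a)" "h (a \<star> b) = pmul (h a) (h b)"
    "unt A = Some e \<Longrightarrow> h e = [:e:]" "lin (\<lambda>a. coeff (h a) k)" "h 0 = 0"
proof -
  show *: "h (a + b) = h a + h b" "h (c \<cdot> a) = psc c (h a)" for a b c
    using assms by (auto simp: is_hom_def linear_iff_add_scale polyalg_vector_space
        vs.vector_space_axioms)
  show "h (a \<star> b) = pmul (h a) (h b)" "unt A = Some e \<Longrightarrow> h e = [:e:]"
    using assms by (auto simp: is_hom_def)
  show "lin (\<lambda>a. coeff (h a) k)" by (simp add: lin_iff *)
  show "h 0 = 0" using *(1)[of 0 0] by simp
qed

lemma is_hom_unique:
  assumes "is_hom A A g" "is_hom A A h" "\<And>i. i \<in> {1..n} \<Longrightarrow> g (x i) = h (x i)"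
  shows "g = h"
proof
  fix a show "g a = h a"
    by (induction a rule: generated)
      (use assms in \<open>simp_all add: homD linD[OF homD(1)]\<close>)
qed

lemma is_hom_comp: "is_hom A A g \<Longrightarrow> is_hom A A h \<Longrightarrow> is_hom A A (g \<circ> h)"
  by (simp add: is_hom_iff lin_iff)

lemma is_hom_ev_comp:
  assumes "is_hom A polyalg h" shows "is_hom A A (\<lambda>a. ev c (h a))"
  using is_hom_ev[of c] assms
  by (auto simp: is_hom_def linear_iff_add_scale polyalg_vector_space vs.vector_space_axioms)

lemma hom_fixes_subalg:
  assumes "is_hom A A h" "\<And>a. a \<in> S \<Longrightarrow> h a = a" "a \<in> subalg A S"
  shows "h a = a"
  using assms(3) by induction (simp_all add: assms(2) homD[OF assms(1)] linD[OF homD(1)[OF assms(1)]])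

subsection \<open>The grading\<close>

abbreviation HC :: "nat \<Rightarrow> 'a set" where "HC \<equiv> hcomp A n x"
abbreviation TL :: "nat \<Rightarrow> 'a set" where "TL \<equiv> tail A n x"

text \<open>The substitution x_i to x_i t multiplies a monomial of degree k by t^k, so the
  coefficients of the image are the homogeneous components. Their being well defined shows that the
  sum of the \<open>HC k\<close> is direct.\<close>

definition grading_hom :: "'a \<Rightarrow> 'a poly" where
  "grading_hom = (SOME h. is_hom A polyalg h \<and> (\<forall>i\<in>{1..n}. h (x i) = monom (x i) 1))"

definition prj :: "nat \<Rightarrow> 'a \<Rightarrow> 'a" where
  "prj k a = coeff (grading_hom a) k"

lemma grading_hom: "is_hom A polyalg grading_hom"
  "i \<in> {1..n} \<Longrightarrow> grading_hom (x i) = monom (x i) 1"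
  using someI_ex[OF ex_poly_hom[of "\<lambda>i. monom (x i) 1"]] by (auto simp: grading_hom_def)

lemma lin_prj: "lin (prj k)"
  using poly_homD(5)[OF grading_hom(1)] by (simp add: prj_def[abs_def])

lemmas prj_lin = linD[OF lin_prj]

lemma prj_mul: "prj k (a \<star> b) = (\<Sum>i\<le>k. prj i a \<star> prj (k - i) b)"
  by (simp add: prj_def poly_homD[OF grading_hom(1)] coeff_pmul)

lemma prj_unit: "unt A = Some e \<Longrightarrow> prj k e = (if k = 0 then e else 0)"
  by (auto simp: prj_def poly_homD[OF grading_hom(1)] coeff_pCons split: nat.splits)

lemma prj_gen: "i \<in> {1..n} \<Longrightarrow> prj k (x i) = (if k = 1 then x i else 0)"
  by (auto simp: prj_def grading_hom)

lemma prj_monomial: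
  assumes "(k, m) \<in> monomials A n x"
  shows "prj i m = (if i = k then m else 0)"
  using assms
proof (induction arbitrary: i rule: monomials.induct)
  case (mult j a k b)
  have "prj i (a \<star> b) = (\<Sum>l\<le>i. if l = j then (if i = j + k then a \<star> b else 0) else 0)"
    unfolding prj_mul by (rule sum.cong) (auto simp: mult.IH mul_left mul_right)
  then show ?case by simp
qed (simp_all add: prj_unit prj_gen)

lemma subspace_hcomp: "vs.subspace (HC k)"
  unfolding hcomp_def by (rule vs.subspace_span)

lemmas hcomp_add = vs.subspace_add[OF subspace_hcomp]
lemmas hcomp_scale = vs.subspace_scale[OF subspace_hcomp]
lemmas hcomp_zero = vs.subspace_0[OF subspace_hcomp]
lemmas hcomp_diff = vs.subspace_diff[OF subspace_hcomp]
lemmas hcomp_neg = vs.subspace_neg[OF subspace_hcomp]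
lemmas hcomp_sum = vs.subspace_sum[OF subspace_hcomp]

lemma subspace_tail: "vs.subspace (TL k)"
  unfolding tail_def by (rule vs.subspace_span)

lemmas tail_add = vs.subspace_add[OF subspace_tail]
lemmas tail_scale = vs.subspace_scale[OF subspace_tail]
lemmas tail_zero = vs.subspace_0[OF subspace_tail]
lemmas tail_diff = vs.subspace_diff[OF subspace_tail]
lemmas tail_neg = vs.subspace_neg[OF subspace_tail]

lemma monomial_in_hcomp: "(k, m) \<in> monomials A n x \<Longrightarrow> m \<in> HC k"
  unfolding hcomp_def by (rule vs.span_base) simp

lemma gen_in_hcomp: "i \<in> {1..n} \<Longrightarrow> x i \<in> HC 1"
  by (intro monomial_in_hcomp monomials.gen)

lemma lin_image_hcomp:
  assumes "lin T" "vs.subspace S" "\<And>m. (k, m) \<in> monomials A n x \<Longrightarrow> T m \<in> S" "a \<in> HC k"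
  shows "T a \<in> S"
proof -
  have "vs.subspace {a. T a \<in> S}"
    using assms(2) by (auto simp: vs.subspace_def linD[OF assms(1)])
  then show ?thesis
    using vs.span_induct[of a "{m. (k, m) \<in> monomials A n x}" "\<lambda>a. T a \<in> S"] assms(3,4)
    by (auto simp: hcomp_def)
qed

lemma hcomp_mul:
  assumes "a \<in> HC i" "b \<in> HC j" shows "a \<star> b \<in> HC (i + j)"
proof (rule lin_image_hcomp[OF mul_lin(1) subspace_hcomp _ assms(1)])
  fix m assume "(i, m) \<in> monomials A n x"
  then show "m \<star> b \<in> HC (i + j)"
    by (intro lin_image_hcomp[OF mul_lin(2) subspace_hcomp _ assms(2)] monomial_in_hcomp monomials.mult)
qed

lemma prj_hcomp:
  assumes "a \<in> HC k" shows "prj i a = (if i = k then a else 0)"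
proof -
  have "lin (\<lambda>a. prj i a - (if i = k then a else 0))"
    by (simp add: lin_iff prj_lin vs.scale_right_diff_distrib)
  from lin_image_hcomp[OF this vs.subspace_single_0 _ assms] show ?thesis
    by (simp add: prj_monomial)
qed

lemma unit_in_hcomp: "unt A = Some e \<Longrightarrow> e \<in> HC 0"
  by (intro monomial_in_hcomp monomials.unit)

lemma prj_in_hcomp: "prj k a \<in> HC k"
proof (induction a arbitrary: k rule: generated)
  case (mult a b)
  then show ?case unfolding prj_mul by (intro hcomp_sum) (metis atMost_iff hcomp_mul le_add_diff_inverse)
qed (auto simp: prj_gen prj_unit prj_lin gen_in_hcomp[simplified] unit_in_hcomp hcomp_zero hcomp_add hcomp_scale)

text \<open>Setting t = 1 undoes the substitution x_i to x_i t, so the coefficients of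
  \<open>grading_hom a\<close> add up to \<open>a\<close>.\<close>

lemma sum_prj: "\<exists>N. a = (\<Sum>k\<le>N. prj k a)"
proof -
  have "(\<lambda>a. ev 1 (grading_hom a)) = id"
    by (rule is_hom_unique[OF is_hom_ev_comp[OF grading_hom(1)]])
      (auto simp: is_hom_iff lin_iff grading_hom ev_monom)
  then have "a = ev 1 (grading_hom a)" by (simp add: fun_eq_iff)
  then show ?thesis by (auto simp: ev_def prj_def)
qed

lemma tail_iff: "a \<in> TL m \<longleftrightarrow> (\<forall>i<m. prj i a = 0)"
proof
  assume "a \<in> TL m"
  then show "\<forall>i<m. prj i a = 0"
    unfolding tail_def
    by (induction rule: vs.span_induct) (auto simp: vs.subspace_def prj_lin prj_hcomp)
next
  assume *: "\<forall>i<m. prj i a = 0"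
  obtain N where N: "a = (\<Sum>k\<le>N. prj k a)" using sum_prj by blast
  have "prj k a \<in> TL m" for k
  proof (cases "k < m")
    case False
    then show ?thesis unfolding tail_def by (intro vs.span_base) (auto intro: prj_in_hcomp)
  qed (use * tail_zero in auto)
  then show "a \<in> TL m" by (subst N) (intro vs.subspace_sum[OF subspace_tail])
qed

lemma tail_mono: "a \<in> TL m \<Longrightarrow> k \<le> m \<Longrightarrow> a \<in> TL k"
  by (auto simp: tail_iff)

lemma tail_0: "a \<in> TL 0" by (simp add: tail_iff)

lemma hcomp_tail: "a \<in> HC m \<Longrightarrow> k \<le> m \<Longrightarrow> a \<in> TL k"
  by (auto simp: tail_iff prj_hcomp)

lemma tail_mul:
  assumes "a \<in> TL i" "b \<in> TL j" shows "a \<star> b \<in> TL (i + j)"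
  unfolding tail_iff prj_mul
proof (intro allI impI sum.neutral ballI)
  fix k l assume "k < i + j" "l \<in> {..k}"
  then have "l < i \<or> k - l < j" by auto
  then show "prj l a \<star> prj (k - l) b = 0"
    using assms by (auto simp: tail_iff mul_left mul_right)
qed

lemma monomial_degree_0: "(0, m) \<in> monomials A n x \<Longrightarrow> unt A = Some m"
proof (induction "0::nat" m rule: monomials.induct)
  case (mult j a k b)
  then show ?case by (auto simp: unit_mul)
qed auto

text \<open>With an identity element, a monomial of degree 1 may still be a product with unit
  factors; these cancel.\<close>

lemma monomial_degree_1: "(1, m) \<in> monomials A n x \<Longrightarrow> m \<in> x ` {1..n}"
proof (induction "1::nat" m rule: monomials.induct)
  case (mult j a k b)
  then have "j = 0 \<and> k = 1 \<or> j = 1 \<and> k = 0" by auto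
  then show ?case
    using mult by (auto dest!: monomial_degree_0 simp: unit_mul)
qed auto

lemma hcomp_0:
  assumes "a \<in> HC 0" shows "a = 0 \<or> (\<exists>e c. unt A = Some e \<and> a = c \<cdot> e)"
proof (cases "unt A")
  case None
  then have "{m. (0, m) \<in> monomials A n x} = {}" by (auto dest: monomial_degree_0)
  then show ?thesis using assms by (simp add: hcomp_def)
next
  case (Some e)
  then have "{m. (0, m) \<in> monomials A n x} = {e}"
    by (auto dest: monomial_degree_0 intro: monomials.unit)
  then show ?thesis using assms Some by (auto simp: hcomp_def vs.span_singleton)
qed

lemma hcomp_1:
  assumes "a \<in> HC 1" shows "\<exists>c. a = (\<Sum>i=1..n. c i \<cdot> x i)"
proof -
  have "{m. (1, m) \<in> monomials A n x} \<subseteq> x ` {1..n}"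
    using monomial_degree_1 by auto
  then have "a \<in> vs.span (x ` {1..n})"
    using assms vs.span_mono by (auto simp: hcomp_def)
  then show ?thesis
  proof (induction rule: vs.span_induct_alt)
    case base
    show ?case by (intro exI[of _ "\<lambda>_. 0"]) simp
  next
    case (step c y z)
    then obtain i d where i: "i \<in> {1..n}" "y = x i" and d: "z = (\<Sum>i=1..n. d i \<cdot> x i)" by auto
    have "(\<Sum>l=1..n. (d l + (if l = i then c else 0)) \<cdot> x l) =
        (\<Sum>l=1..n. d l \<cdot> x l) + (\<Sum>l=1..n. if l = i then c \<cdot> x l else 0)"
      by (subst sum.distrib[symmetric], rule sum.cong) (auto simp: vs.scale_left_distrib)
    then show ?case
      using i d by (intro exI[of _ "\<lambda>l. d l + (if l = i then c else 0)"]) (simp add: add.commute)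
  qed
qed

subsection \<open>Operators raising the filtration\<close>

definition raises :: "nat \<Rightarrow> ('a \<Rightarrow> 'a) \<Rightarrow> bool" where
  "raises k T \<longleftrightarrow> lin T \<and> (\<forall>m. \<forall>a\<in>TL m. T a \<in> TL (m + k))"

lemma raises_lin: "raises k T \<Longrightarrow> lin T"
  by (simp add: raises_def)

lemma raisesD: "raises k T \<Longrightarrow> a \<in> TL m \<Longrightarrow> T a \<in> TL (m + k)"
  by (simp add: raises_def)

lemma raisesI:
  assumes "lin T" "\<And>m a. (m, a) \<in> monomials A n x \<Longrightarrow> T a \<in> TL (m + k)"
  shows "raises k T"
  unfolding raises_def
proof (intro conjI allI ballI \<open>lin T\<close>)
  fix m a assume a: "a \<in> TL m"
  have *: "T b \<in> TL (l + k)" if "b \<in> HC l" for l b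
    by (rule lin_image_hcomp[OF assms(1) subspace_tail assms(2) that])
  have **: "T (prj l a) \<in> TL (m + k)" for l
  proof (cases "l < m")
    case True
    then show ?thesis using a by (simp add: tail_iff linD[OF assms(1)] tail_zero prj_lin)
  next
    case False
    then show ?thesis by (intro tail_mono[OF *[OF prj_in_hcomp]]) simp
  qed
  obtain N where "a = (\<Sum>l\<le>N. prj l a)" using sum_prj by blast
  then have "T a = (\<Sum>l\<le>N. T (prj l a))" using linD(6)[OF assms(1)] by metis
  then show "T a \<in> TL (m + k)" using ** by (simp add: vs.subspace_sum[OF subspace_tail])
qed

lemma raises_comp:
  assumes "raises k S" "raises l T" shows "raises (k + l) (\<lambda>a. S (T a))"
  unfolding raises_def
proof (intro conjI allI ballI)
  show "lin (\<lambda>a. S (T a))"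
    using assms by (simp add: raises_def lin_iff)
  fix m a assume "a \<in> TL m"
  then show "S (T a) \<in> TL (m + (k + l))"
    using raisesD[OF assms(1) raisesD[OF assms(2), of a m]] by (simp add: ac_simps)
qed

lemma raises_add: "raises k S \<Longrightarrow> raises k T \<Longrightarrow> raises k (\<lambda>a. S a + T a)"
  unfolding raises_def by (auto simp: lin_iff vs.scale_right_distrib tail_add)

lemma raises_diff: "raises k S \<Longrightarrow> raises k T \<Longrightarrow> raises k (\<lambda>a. S a - T a)"
  unfolding raises_def by (auto simp: lin_iff vs.scale_right_diff_distrib tail_diff)

lemma raises_uminus: "raises k T \<Longrightarrow> raises k (\<lambda>a. - T a)"
  unfolding raises_def by (auto simp: lin_iff tail_neg)

lemma raises_mono: "raises k T \<Longrightarrow> l \<le> k \<Longrightarrow> raises l T"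
  unfolding raises_def by (meson add_left_mono tail_mono)

lemma raises_id: "raises 0 (\<lambda>a. a)"
  by (auto simp: raises_def lin_iff)

lemma raises_0: "raises k (\<lambda>a. 0)"
  by (auto simp: raises_def lin_iff tail_zero)

lemma raises_hom:
  assumes "is_hom A A h" "\<And>i. i \<in> {1..n} \<Longrightarrow> h (x i) \<in> TL 1"
  shows "raises 0 h"
proof (rule raisesI[OF homD(1)[OF assms(1)]])
  fix m a assume "(m, a) \<in> monomials A n x"
  then show "h a \<in> TL (m + 0)"
    using assms(2) by induction (simp_all add: homD[OF assms(1)] tail_mul tail_0)
qed

text \<open>Here \<phi> = 1 + D + (order k+1) as operators on the filtered space A. Neither is
  \<phi> required to be an automorphism nor \<open>D\<close> a derivation, and \<open>D = 0\<close>
  is allowed, unlike for T(\<phi>).\<close>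

definition tangent :: "nat \<Rightarrow> ('a \<Rightarrow> 'a) \<Rightarrow> ('a \<Rightarrow> 'a) \<Rightarrow> bool" where
  "tangent k \<phi> D \<longleftrightarrow> raises k D \<and> raises (k + 1) (\<lambda>a. \<phi> a - a - D a)"

lemma tangent_raises_0:
  assumes "tangent k \<phi> D" shows "raises 0 \<phi>"
proof -
  have "raises 0 (\<lambda>a. (\<phi> a - a - D a) + (D a + a))"
    using assms unfolding tangent_def
    by (intro raises_add raises_id) (elim conjE, erule raises_mono, simp)+
  then show ?thesis by (simp add: algebra_simps)
qed

text \<open>Leading parts add, because the cross term \<open>D (E a)\<close> raises the filtration
  by 2k, which is at least k+1 when k is positive.\<close>

lemma tangent_comp:
  assumes "1 \<le> k" "tangent k \<phi> D" "tangent k \<psi> E"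
  shows "tangent k (\<phi> \<circ> \<psi>) (\<lambda>a. D a + E a)"
proof -
  define r where "r a = \<phi> a - a - D a" for a
  define s where "s a = \<psi> a - a - E a" for a
  have D: "raises k D" and E: "raises k E" and r: "raises (k + 1) r" and s: "raises (k + 1) s"
    using assms by (auto simp: tangent_def r_def[abs_def] s_def[abs_def])
  have "\<phi> (\<psi> a) - a - (D a + E a) = s a + D (E a) + D (s a) + r (\<psi> a)" for a
    by (simp add: r_def s_def linD[OF raises_lin[OF D]] algebra_simps)
  moreover have "raises (k + 1) (\<lambda>a. s a + D (E a) + D (s a) + r (\<psi> a))"
    using assms(1) raises_comp[OF D E] raises_comp[OF D s]
      raises_comp[OF r tangent_raises_0[OF assms(3)]] s
    by (intro raises_add) (erule raises_mono, simp)+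
  ultimately show ?thesis
    using D E by (simp add: tangent_def raises_add)
qed

text \<open>With \<phi> = 1 + D + r and \<psi> = 1 + E + s, the difference \<phi>\<psi> -
  \<psi>\<phi> equals B + C, where B is the bracket and C collects the products that contain a
  remainder. Writing each argument as a = \<psi>(\<phi>(g a)) avoids any series for the inverses:
  the error is C(g a) - B(M(g a)) with M = \<psi>\<phi> - 1, and M raises the filtration.\<close>

lemma tangent_commutator:
  assumes k: "1 \<le> k" "1 \<le> l" and "tangent k \<phi> D" "tangent l \<psi> E" and bij: "bij \<phi>" "bij \<psi>"
    and inv: "raises 0 (inv \<phi>)" "raises 0 (inv \<psi>)"
  shows "tangent (k + l) (\<phi> \<circ> \<psi> \<circ> inv \<phi> \<circ> inv \<psi>) (\<lambda>a. D (E a) - E (D a))"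
proof -
  define r where "r a = \<phi> a - a - D a" for a
  define s where "s a = \<psi> a - a - E a" for a
  define g where "g a = inv \<phi> (inv \<psi> a)" for a
  define B where "B a = D (E a) - E (D a)" for a
  have D: "raises k D" and E: "raises l E" and r: "raises (k + 1) r" and s: "raises (l + 1) s"
    using assms by (auto simp: tangent_def r_def[abs_def] s_def[abs_def])
  note lins = linD[OF raises_lin[OF D]] linD[OF raises_lin[OF E]]
    linD[OF raises_lin[OF r]] linD[OF raises_lin[OF s]]
  have B: "raises (k + l) B"
    using raises_comp[OF D E] raises_comp[OF E D]
    unfolding B_def[abs_def] by (intro raises_diff) (auto simp: add.commute)
  have g: "raises 0 g"
    using raises_comp[OF inv] by (simp add: g_def[abs_def])
  have \<phi>: "\<phi> (inv \<phi> a) = a" and \<psi>: "\<psi> (inv \<psi> a) = a" for a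
    using bij by (simp_all add: bij_is_surj surj_f_inv_f)
  have phi: "\<phi> a = a + D a + r a" and psi: "\<psi> a = a + E a + s a" for a
    by (simp_all add: r_def s_def)
  have gi: "\<psi> (\<phi> (g a)) = a" for a by (simp add: g_def \<phi> \<psi>)
  define C where "C b = D (s b) + r (E b) + r (s b) - E (r b) - s (D b) - s (r b)" for b
  define M where "M b = D b + r b + E (\<phi> b) + s (\<phi> b)" for b
  have C: "raises (k + l + 1) C"
    using raises_comp[OF D s] raises_comp[OF r E] raises_comp[OF r s] raises_comp[OF E r]
      raises_comp[OF s D] raises_comp[OF s r]
    unfolding C_def[abs_def] by (intro raises_diff raises_add) (erule raises_mono, simp)+
  have M: "raises 1 M"
    using k D r raises_comp[OF E tangent_raises_0[OF assms(3)]]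
      raises_comp[OF s tangent_raises_0[OF assms(3)]]
    unfolding M_def[abs_def] by (intro raises_add) (erule raises_mono, simp)+
  have 1: "\<phi> (\<psi> b) - \<psi> (\<phi> b) = B b + C b" for b
    by (simp add: phi psi B_def C_def lins algebra_simps)
  have 2: "\<psi> (\<phi> b) = b + M b" for b
    by (simp add: M_def phi psi[of "_ + _"])
  have "(\<phi> \<circ> \<psi> \<circ> inv \<phi> \<circ> inv \<psi>) a - a - B a = C (g a) - B (M (g a))" for a
  proof -
    have "(\<phi> \<circ> \<psi> \<circ> inv \<phi> \<circ> inv \<psi>) a - a - B a =
        \<phi> (\<psi> (g a)) - \<psi> (\<phi> (g a)) - B (\<psi> (\<phi> (g a)))"
      unfolding gi by (simp add: g_def)
    also have "\<dots> = C (g a) - B (M (g a))"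
      unfolding 1 by (simp add: 2 linD[OF raises_lin[OF B]])
    finally show ?thesis .
  qed
  moreover have "raises (k + l + 1) (\<lambda>a. C (g a) - B (M (g a)))"
    using raises_comp[OF C g] raises_comp[OF B raises_comp[OF M g]]
    by (intro raises_diff) (erule raises_mono, simp)+
  ultimately show ?thesis
    using B by (simp add: tangent_def B_def[abs_def])
qed

lemma tangent_conj:
  assumes "tangent k \<phi> D" "raises 0 \<mu>" "raises 0 \<nu>" "\<And>a. \<mu> (\<nu> a) = a"
  shows "tangent k (\<mu> \<circ> \<phi> \<circ> \<nu>) (\<lambda>a. \<mu> (D (\<nu> a)))"
proof -
  have "raises k (\<lambda>a. \<mu> (D (\<nu> a)))"
    "raises (k + 1) (\<lambda>a. \<mu> (\<phi> (\<nu> a) - \<nu> a - D (\<nu> a)))"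
    using assms(1) raises_comp[OF assms(2) raises_comp[OF _ assms(3)], of k D]
      raises_comp[OF assms(2) raises_comp[OF _ assms(3)], of "k + 1" "\<lambda>a. \<phi> a - a - D a"]
    by (auto simp: tangent_def)
  then show ?thesis
    by (simp add: tangent_def linD[OF raises_lin[OF assms(2)]] assms(4))
qed

subsection \<open>Automorphisms\<close>

lemma AutD: "\<phi> \<in> Aut A \<Longrightarrow> is_hom A A \<phi>" "\<phi> \<in> Aut A \<Longrightarrow> bij \<phi>"
  by (simp_all add: Aut_def)

lemma Aut_inv_apply: "\<phi> \<in> Aut A \<Longrightarrow> inv \<phi> (\<phi> a) = a" "\<phi> \<in> Aut A \<Longrightarrow> \<phi> (inv \<phi> a) = a"
  using AutD(2)[of \<phi>] by (simp_all add: bij_is_inj bij_is_surj surj_f_inv_f)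

lemma Aut_id: "id \<in> Aut A"
  by (simp add: Aut_def is_hom_iff lin_iff)

lemma Aut_comp: "\<phi> \<in> Aut A \<Longrightarrow> \<psi> \<in> Aut A \<Longrightarrow> \<phi> \<circ> \<psi> \<in> Aut A"
  by (simp add: Aut_def is_hom_comp bij_comp)

lemma Aut_inv:
  assumes "\<phi> \<in> Aut A" shows "inv \<phi> \<in> Aut A"
proof -
  note h = AutD(1)[OF assms] and i = Aut_inv_apply[OF assms]
  have inj: "a = b" if "\<phi> a = \<phi> b" for a b using i(1) that by metis
  have "inv \<phi> (a + b) = inv \<phi> a + inv \<phi> b" "inv \<phi> (c \<cdot> a) = c \<cdot> inv \<phi> a"
    "inv \<phi> (a \<star> b) = inv \<phi> a \<star> inv \<phi> b" for a b c
    by (rule inj, simp add: homD[OF h] linD[OF homD(1)[OF h]] i)+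
  moreover have "inv \<phi> e = e" if "unt A = Some e" for e
    by (rule inj) (simp add: homD(3)[OF h that] i)
  ultimately show ?thesis
    by (simp add: Aut_def is_hom_iff lin_iff bij_imp_bij_inv AutD(2)[OF assms])
qed

lemma Aut_of_inverse:
  assumes "is_hom A A g" "is_hom A A h"
    and "\<And>i. i \<in> {1..n} \<Longrightarrow> g (h (x i)) = x i" "\<And>i. i \<in> {1..n} \<Longrightarrow> h (g (x i)) = x i"
  shows "g \<in> Aut A" "inv g = h"
proof -
  have "is_hom A A id" by (simp add: is_hom_iff lin_iff)
  then have gh: "g \<circ> h = id" "h \<circ> g = id"
    using assms by (auto intro!: is_hom_unique is_hom_comp)
  then show "g \<in> Aut A" using assms by (simp add: Aut_def o_bij)
  show "inv g = h" using gh by (metis inv_unique_comp)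
qed

text \<open>An automorphism fixes constants. A nonzero constant part of the preimage of x_i would
  therefore reappear in x_i, since \<phi> maps the remaining part into positive degrees.\<close>

lemma raises_inv:
  assumes \<phi>: "\<phi> \<in> Aut A" and t: "\<And>i. i \<in> {1..n} \<Longrightarrow> \<phi> (x i) \<in> TL 1"
  shows "raises 0 (inv \<phi>)"
proof (rule raises_hom[OF AutD(1)[OF Aut_inv[OF \<phi>]]])
  fix i assume i: "i \<in> {1..n}"
  define b where "b = inv \<phi> (x i)"
  note lin\<phi> = linD[OF homD(1)[OF AutD(1)[OF \<phi>]]]
  have "\<phi> (prj 0 b) = prj 0 b"
    using hcomp_0[OF prj_in_hcomp[of 0 b]] by (auto simp: lin\<phi> homD(3)[OF AutD(1)[OF \<phi>]])
  moreover have "b - prj 0 b \<in> TL 1"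
    using prj_hcomp[OF prj_in_hcomp[of 0 b]] by (simp add: tail_iff prj_lin)
  then have "\<phi> (b - prj 0 b) \<in> TL 1"
    using raisesD[OF raises_hom[OF AutD(1)[OF \<phi>] t]] by simp
  moreover have "\<phi> b \<in> TL 1"
    using i hcomp_tail[OF gen_in_hcomp] by (simp add: b_def Aut_inv_apply[OF \<phi>])
  ultimately have "prj 0 b \<in> TL 1"
    using tail_diff by (fastforce simp: lin\<phi>)
  then have "prj 0 b = 0"
    using prj_hcomp[OF prj_in_hcomp[of 0 b], of 0] by (simp add: tail_iff)
  then show "inv \<phi> (x i) \<in> TL 1" by (simp add: tail_iff flip: b_def)
qed

text \<open>The substitution and its candidate inverse both fix \<open>f\<close>, in which x_i does
  not occur; hence they invert each other on the generators.\<close>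

lemma ex_elementary:
  assumes i: "i \<in> {1..n}" and "\<alpha> \<noteq> 0" and f: "f \<in> subalg A (x ` ({1..n} - {i}))"
  obtains \<phi> where "\<phi> \<in> elementary A n x" "\<phi> (x i) = \<alpha> \<cdot> x i + f"
    "\<And>j. j \<in> {1..n} \<Longrightarrow> j \<noteq> i \<Longrightarrow> \<phi> (x j) = x j"
    "inv \<phi> (x i) = inverse \<alpha> \<cdot> (x i - f)"
    "\<And>j. j \<in> {1..n} \<Longrightarrow> j \<noteq> i \<Longrightarrow> inv \<phi> (x j) = x j"
proof -
  obtain g where g: "is_hom A A g" and gx: "\<And>j. j \<in> {1..n} \<Longrightarrow> g (x j) = (if j = i then \<alpha> \<cdot> x i + f else x j)"
    using ex_hom[of "\<lambda>j. if j = i then \<alpha> \<cdot> x i + f else x j"] by blast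
  obtain h where h: "is_hom A A h"
    and hx: "\<And>j. j \<in> {1..n} \<Longrightarrow> h (x j) = (if j = i then inverse \<alpha> \<cdot> (x i - f) else x j)"
    using ex_hom[of "\<lambda>j. if j = i then inverse \<alpha> \<cdot> (x i - f) else x j"] by blast
  have gf: "g f = f"
    by (rule hom_fixes_subalg[OF g _ f]) (auto simp: gx split: if_splits)
  have hf: "h f = f"
    by (rule hom_fixes_subalg[OF h _ f]) (auto simp: hx split: if_splits)
  then have *: "g (h (x j)) = x j" "h (g (x j)) = x j" if "j \<in> {1..n}" for j
    using that \<open>\<alpha> \<noteq> 0\<close> i
    by (auto simp: gx hx gf hf linD[OF homD(1)[OF g]] linD[OF homD(1)[OF h]])
  have "g \<in> Aut A" "inv g = h" using Aut_of_inverse[OF g h *] by auto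
  moreover have "g \<in> elementary A n x"
    using \<open>g \<in> Aut A\<close> assms unfolding elementary_def
    by (auto simp: gx intro!: bexI[of _ i] exI[of _ \<alpha>] exI[of _ f])
  ultimately show thesis using that[of g] i by (auto simp: gx hx)
qed

lemma tame_Aut: "\<phi> \<in> tame A n x \<Longrightarrow> \<phi> \<in> Aut A"
  proof (induction rule: tame.induct)
  case (gen \<phi>)
  then show ?case by (simp add: elementary_def)
qed (rule Aut_id Aut_comp Aut_inv; assumption)+

lemma subalg_sum: "finite I \<Longrightarrow> (\<And>i. i \<in> I \<Longrightarrow> f i \<in> subalg A S) \<Longrightarrow> sum f I \<in> subalg A S"
  by (induction I rule: finite_induct) (auto intro: subalg.intros)

lemma scale_unit_subalg: "a \<in> HC 0 \<Longrightarrow> a \<in> subalg A S"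
  using hcomp_0[of a] by (auto intro: subalg.intros)

subsection \<open>Derivations\<close>

lemma Der_iff: "D \<in> Der A \<longleftrightarrow> lin D \<and> (\<forall>a b. D (a \<star> b) = D a \<star> b + a \<star> D b)"
  by (simp add: Der_def)

lemma DerD: "D \<in> Der A \<Longrightarrow> lin D" "D \<in> Der A \<Longrightarrow> D (a \<star> b) = D a \<star> b + a \<star> D b"
  by (simp_all add: Der_iff)

lemma Der_unit:
  assumes "D \<in> Der A" "unt A = Some e" shows "D e = 0"
  using DerD(2)[OF assms(1), of e e] by (simp add: unit_mul[OF assms(2)])

lemma Der_hcomp_0: "D \<in> Der A \<Longrightarrow> a \<in> HC 0 \<Longrightarrow> D a = 0"
  using hcomp_0[of a] by (auto simp: Der_unit linD[OF DerD(1)])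

lemma Der_unique:
  assumes "D \<in> Der A" "E \<in> Der A" "\<And>i. i \<in> {1..n} \<Longrightarrow> D (x i) = E (x i)"
  shows "D = E"
proof
  fix a show "D a = E a"
    by (induction a rule: generated)
      (use assms in \<open>simp_all add: DerD(2) Der_unit linD[OF DerD(1)]\<close>)
qed

lemma Der_0: "(\<lambda>a. 0) \<in> Der A"
  by (simp add: Der_iff lin_iff mul_left mul_right)

lemma Der_add: "D \<in> Der A \<Longrightarrow> E \<in> Der A \<Longrightarrow> (\<lambda>a. D a + E a) \<in> Der A"
  by (simp add: Der_iff lin_iff mul_left mul_right vs.scale_right_distrib algebra_simps)

lemma Der_scale: "D \<in> Der A \<Longrightarrow> (\<lambda>a. c \<cdot> D a) \<in> Der A"
  by (simp add: Der_iff lin_iff mul_left mul_right vs.scale_right_distrib mult.commute)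

lemma Der_sum: "(\<And>i. i \<in> I \<Longrightarrow> D i \<in> Der A) \<Longrightarrow> (\<lambda>a. \<Sum>i\<in>I. D i a) \<in> Der A"
  by (induction I rule: infinite_finite_induct) (simp_all add: Der_0 Der_add)

lemma Der_bracket:
  assumes "D \<in> Der A" "E \<in> Der A" shows "(\<lambda>a. D (E a) - E (D a)) \<in> Der A"
  unfolding Der_iff lin_iff
  by (simp add: DerD(2)[OF assms(1)] DerD(2)[OF assms(2)] linD[OF DerD(1)[OF assms(1)]]
    linD[OF DerD(1)[OF assms(2)]] mul_left mul_right vs.scale_right_diff_distrib algebra_simps)

lemma Der_conj:
  assumes "D \<in> Der A" "\<phi> \<in> Aut A"
  shows "(\<lambda>a. \<phi> (D (inv \<phi> a))) \<in> Der A"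
  unfolding Der_iff lin_iff
  by (simp add: DerD(2)[OF assms(1)] linD[OF DerD(1)[OF assms(1)]] linD[OF homD(1)[OF AutD(1)]]
      assms(2) Aut_inv homD(2)[OF AutD(1)] Aut_inv_apply)

text \<open>The derivation is the derivative at \<open>t = 0\<close> of the substitution \<open>x\<^sub>j \<mapsto> x\<^sub>j + t f\<^sub>j\<close>, a
  homomorphism to the algebra of polynomials in \<open>t\<close>.\<close>

lemma ex_flow:
  obtains H where "is_hom A polyalg H" "\<And>j. j \<in> {1..n} \<Longrightarrow> H (x j) = [:x j, f j:]"
    "\<And>a. coeff (H a) 0 = a" "\<And>a. coeff (H a) 1 = vfield A n x f a"
    "vfield A n x f \<in> Der A" "\<And>j. j \<in> {1..n} \<Longrightarrow> vfield A n x f (x j) = f j"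
proof -
  obtain H where H: "is_hom A polyalg H" and Hx: "\<And>j. j \<in> {1..n} \<Longrightarrow> H (x j) = [:x j, f j:]"
    using ex_poly_hom[of "\<lambda>j. [:x j, f j:]"] by blast
  \<comment> \<open>Once the constant coefficient is the identity, the linear coefficient of the
    product \<open>pmul (H a) (H b)\<close> is the Leibniz rule.\<close>
  have "(\<lambda>a. coeff (H a) 0) = id"
    by (rule is_hom_unique)
      (auto simp: is_hom_iff lin_iff poly_homD[OF H] coeff_pmul Hx)
  then have 0: "coeff (H a) 0 = a" for a by (simp add: fun_eq_iff)
  define D where "D a = coeff (H a) 1" for a
  have D: "D \<in> Der A" "D (x j) = f j" if "j \<in> {1..n}" for j
    using that by (auto simp: Der_iff lin_iff poly_homD[OF H] coeff_pmul 0 Hx D_def add.commute)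
  have D': "D \<in> Der A"
    by (auto simp: Der_iff lin_iff poly_homD[OF H] coeff_pmul 0 Hx D_def add.commute)
  have "vfield A n x f = D"
    unfolding vfield_def
    by (rule the_equality) (use D D' Der_unique in auto)
  then show thesis using that[OF H Hx 0] D D' by (simp add: D_def)
qed

lemma vfield_Der: "vfield A n x f \<in> Der A"
  and vfield_gen: "j \<in> {1..n} \<Longrightarrow> vfield A n x f (x j) = f j"
  using ex_flow[of f] by blast+

lemma vfield_eqI: "D \<in> Der A \<Longrightarrow> (\<And>j. j \<in> {1..n} \<Longrightarrow> f j = D (x j)) \<Longrightarrow> vfield A n x f = D"
  by (intro Der_unique vfield_Der) (simp_all add: vfield_gen)

text \<open>The index is that of the component of \<open>A\<close> containing the \<open>D x\<^sub>j\<close>, so \<open>hdeg p\<close> describes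
  \<open>L\<^sub>p\<^sub>-\<^sub>1\<close>.\<close>

definition hdeg :: "nat \<Rightarrow> ('a \<Rightarrow> 'a) \<Rightarrow> bool" where
  "hdeg p D \<longleftrightarrow> D \<in> Der A \<and> (\<forall>j\<in>{1..n}. D (x j) \<in> HC p)"

lemma hdeg_iff_der_comp: "hdeg p D \<longleftrightarrow> D \<in> der_comp A n x (int p - 1)"
proof
  assume "hdeg p D"
  then show "D \<in> der_comp A n x (int p - 1)"
    unfolding der_comp_def hdeg_def
    by (auto intro!: exI[of _ "\<lambda>j. D (x j)"] vfield_eqI[symmetric])
qed (auto simp: der_comp_def hdeg_def vfield_Der vfield_gen)

lemma hdeg_Der: "hdeg p D \<Longrightarrow> D \<in> Der A"
  by (simp add: hdeg_def)

lemma hdeg_gen: "hdeg p D \<Longrightarrow> j \<in> {1..n} \<Longrightarrow> D (x j) \<in> HC p"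
  by (simp add: hdeg_def)

lemma hdeg_vfield: "hdeg p (vfield A n x f) \<longleftrightarrow> (\<forall>j\<in>{1..n}. f j \<in> HC p)"
  by (simp add: hdeg_def vfield_Der vfield_gen)

lemma hdeg_hcomp:
  assumes "hdeg p D" "a \<in> HC m" "m \<ge> 1"
  shows "D a \<in> HC (m + p - 1)"
proof (rule lin_image_hcomp[OF DerD(1)[OF hdeg_Der[OF assms(1)]] subspace_hcomp _ assms(2)])
  note D = hdeg_Der[OF assms(1)]
  fix a assume "(m, a) \<in> monomials A n x"
  \<comment> \<open>A factor of degree 0 needs its own clause: for \<open>p = 0\<close> the
    truncated index would only place its image in \<open>HC 0\<close>, which is too weak for the
    product; in fact derivations kill constants.\<close>
  then have "if m = 0 then D a = 0 else D a \<in> HC (m + p - 1)"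
  proof induction
    case (gen i)
    then show ?case using hdeg_gen[OF assms(1)] by simp
  next
    case (mult j a k b)
    note hc = monomial_in_hcomp[OF mult.hyps(1)] monomial_in_hcomp[OF mult.hyps(2)]
    have "D a \<star> b \<in> HC (j + k + p - 1)"
      using mult.IH(1) hcomp_mul[OF _ hc(2), of "D a" "j + p - 1"]
      by (cases "j = 0") (simp_all add: mul_left hcomp_zero algebra_simps)
    moreover have "a \<star> D b \<in> HC (j + k + p - 1)"
      using mult.IH(2) hcomp_mul[OF hc(1), of "D b" "k + p - 1"]
      by (cases "k = 0") (simp_all add: mul_right hcomp_zero algebra_simps)
    ultimately show ?case
      using mult.IH by (auto simp: DerD(2)[OF D] mul_left mul_right intro: hcomp_add)
  qed (simp add: Der_unit[OF D])
  then show "D a \<in> HC (m + p - 1)" using assms(3) by simp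
qed

lemma hdeg_add: "hdeg p D \<Longrightarrow> hdeg p E \<Longrightarrow> hdeg p (\<lambda>a. D a + E a)"
  by (simp add: hdeg_def Der_add hcomp_add)

lemma hdeg_scale: "hdeg p D \<Longrightarrow> hdeg p (\<lambda>a. c \<cdot> D a)"
  by (simp add: hdeg_def Der_scale hcomp_scale)

lemma hdeg_0: "hdeg p (\<lambda>a. 0)"
  by (simp add: hdeg_def Der_0 hcomp_zero)

lemma hdeg_bracket:
  assumes "hdeg p D" "hdeg q E"
  shows "hdeg (p + q - 1) (\<lambda>a. D (E a) - E (D a))"
proof -
  have *: "D (E (x j)) \<in> HC (p + q - 1)" if "hdeg p D" "hdeg q E" "j \<in> {1..n}" for j p q D E
  proof (cases "q = 0")
    case True
    then show ?thesis
      using Der_hcomp_0[OF hdeg_Der[OF that(1)], of "E (x j)"] hdeg_gen[OF that(2,3)]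
      by (simp add: hcomp_zero)
  next
    case False
    then show ?thesis
      using hdeg_hcomp[OF that(1) hdeg_gen[OF that(2,3)]] by (simp add: add.commute)
  qed
  show ?thesis
    unfolding hdeg_def
    using *[OF assms] *[OF assms(2,1)] Der_bracket[OF assms[THEN hdeg_Der]]
    by (auto intro!: hcomp_diff simp: add.commute)
qed

lemma Der_raises:
  assumes D: "D \<in> Der A" and t: "\<And>i. i \<in> {1..n} \<Longrightarrow> D (x i) \<in> TL (k + 1)"
  shows "raises k D"
proof (rule raisesI[OF DerD(1)[OF D]])
  fix m a assume "(m, a) \<in> monomials A n x"
  then show "D a \<in> TL (m + k)"
  proof induction
    case (mult j a l b)
    then have "D a \<star> b \<in> TL (j + k + l)" "a \<star> D b \<in> TL (j + (l + k))"
      using hcomp_tail[OF monomial_in_hcomp] by (auto intro!: tail_mul)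
    then show ?case by (simp add: DerD(2)[OF D] tail_add algebra_simps)
  qed (use t in \<open>auto simp: Der_unit[OF D] tail_zero\<close>)
qed

text \<open>The estimate passes from generators to products: in the error on a product the only term
  free of remainders is \<open>D a \<star> D b\<close>, and it raises the degree by 2k, at least
  k+1.\<close>

lemma tangentI:
  assumes h: "is_hom A A \<phi>" and D: "D \<in> Der A" and k: "1 \<le> k"
    and t: "\<And>i. i \<in> {1..n} \<Longrightarrow> D (x i) \<in> TL (k + 1)"
    and s: "\<And>i. i \<in> {1..n} \<Longrightarrow> \<phi> (x i) - x i - D (x i) \<in> TL (k + 2)"
  shows "tangent k \<phi> D"
proof -
  note Dk = Der_raises[OF D t]
  note lins = linD[OF homD(1)[OF h]] linD[OF DerD(1)[OF D]]
  have "raises (k + 1) (\<lambda>a. \<phi> a - a - D a)"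
  proof (rule raisesI)
    show "lin (\<lambda>a. \<phi> a - a - D a)"
      by (simp add: lin_iff lins vs.scale_right_diff_distrib algebra_simps)
    fix m a assume "(m, a) \<in> monomials A n x"
    then show "\<phi> a - a - D a \<in> TL (m + (k + 1))"
    proof induction
      case (mult j a l b)
      define r where "r a = \<phi> a - a - D a" for a
      have a: "a \<in> TL j" "D a \<in> TL (j + k)" "r a \<in> TL (j + (k + 1))"
        and b: "b \<in> TL l" "D b \<in> TL (l + k)" "r b \<in> TL (l + (k + 1))"
        using mult hcomp_tail[OF monomial_in_hcomp] raisesD[OF Dk] by (auto simp: r_def)
      have "D a \<star> D b + (a \<star> r b + (D a \<star> r b + (r a \<star> b + (r a \<star> D b + r a \<star> r b))))
          \<in> TL (j + l + (k + 1))"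
        using tail_mul[OF a(2) b(2)] tail_mul[OF a(1) b(3)] tail_mul[OF a(2) b(3)]
          tail_mul[OF a(3) b(1)] tail_mul[OF a(3) b(2)] tail_mul[OF a(3) b(3)] k
        by (intro tail_add) (erule tail_mono, simp)+
      moreover have "\<phi> a = a + D a + r a" "\<phi> b = b + D b + r b" by (simp_all add: r_def)
      then have "\<phi> (a \<star> b) - a \<star> b - D (a \<star> b) =
          D a \<star> D b + (a \<star> r b + (D a \<star> r b + (r a \<star> b + (r a \<star> D b + r a \<star> r b))))"
        by (simp add: homD(2)[OF h] DerD(2)[OF D] mul_left mul_right algebra_simps)
      ultimately show ?case by simp
    qed (use s in \<open>auto simp: homD(3)[OF h] Der_unit[OF D] tail_zero\<close>)
  qed
  then show ?thesis using Dk by (simp add: tangent_def)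
qed

lemma tangent_IA:
  assumes "tangent k \<phi> D" "\<phi> \<in> Aut A"
  shows "\<phi> \<in> IA A n x k"
proof -
  have "\<phi> (x j) - x j \<in> TL (k + 1)" if "j \<in> {1..n}" for j
  proof -
    have "x j \<in> TL 1" using hcomp_tail[OF gen_in_hcomp[OF that]] by simp
    then have "D (x j) \<in> TL (1 + k)" "\<phi> (x j) - x j - D (x j) \<in> TL (1 + (k + 1))"
      using assms(1) unfolding tangent_def by (blast dest: raisesD)+
    then have "(\<phi> (x j) - x j - D (x j)) + D (x j) \<in> TL (k + 1)"
      by (intro tail_add) (auto elim: tail_mono)
    then show ?thesis by simp
  qed
  then show ?thesis using assms(2) by (simp add: IA_def)
qed

lemma vfield_add: "vfield A n x (\<lambda>j. f j + g j) = (\<lambda>a. vfield A n x f a + vfield A n x g a)"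
  by (rule vfield_eqI) (simp_all add: Der_add vfield_Der vfield_gen)

lemma vfield_scale: "vfield A n x (\<lambda>j. c \<cdot> f j) = (\<lambda>a. c \<cdot> vfield A n x f a)"
  by (rule vfield_eqI) (simp_all add: Der_scale vfield_Der vfield_gen)

lemma vfield_0: "vfield A n x (\<lambda>j. 0) = (\<lambda>a. 0)"
  by (rule vfield_eqI) (simp_all add: Der_0)

lemma Der_subalg:
  assumes D: "D \<in> Der A" and "\<And>a. a \<in> S \<Longrightarrow> D a \<in> subalg A S" and "a \<in> subalg A S"
  shows "D a \<in> subalg A S"
  using assms(3)
proof induction
  case (mult a b)
  then show ?case by (simp add: DerD(2)[OF D] subalg.add subalg.mult)
qed (auto simp: Der_unit[OF D] linD[OF DerD(1)[OF D]] assms(2) intro: subalg.intros)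

subsection \<open>The positive part of the Lie algebra\<close>

text \<open>Bracketing with \<open>L\<^sub>-\<^sub>1\<close> is not among the rules: it corresponds to no operation on \<open>IA\<close>, and closure under it is a
  theorem.\<close>

inductive pos_lie :: "nat \<Rightarrow> ('a \<Rightarrow> 'a) \<Rightarrow> bool" where
  gen: "2 \<le> p \<Longrightarrow> f \<in> HC p \<Longrightarrow> f \<in> subalg A (x ` {2..n}) \<Longrightarrow>
    pos_lie p (vfield A n x (\<lambda>j. if j = 1 then f else 0))"
| add: "pos_lie p D \<Longrightarrow> pos_lie p E \<Longrightarrow> pos_lie p (\<lambda>a. D a + E a)"
| scale: "pos_lie p D \<Longrightarrow> pos_lie p (\<lambda>a. c \<cdot> D a)"
| linear: "pos_lie p D \<Longrightarrow> hdeg 1 E \<Longrightarrow> pos_lie p (\<lambda>a. E (D a) - D (E a))"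
| bracket: "pos_lie p D \<Longrightarrow> pos_lie q E \<Longrightarrow> pos_lie (p + q - 1) (\<lambda>a. D (E a) - E (D a))"

lemma pos_lie_hdeg: "pos_lie p D \<Longrightarrow> 2 \<le> p \<and> hdeg p D"
proof (induction rule: pos_lie.induct)
  case (linear p D E)
  then show ?case using hdeg_bracket[of 1 E p D] by simp
next
  case (bracket p D q E)
  then show ?case using hdeg_bracket[of p D q E] by auto
qed (simp_all add: hdeg_vfield hcomp_zero hdeg_add hdeg_scale)

lemma pos_lie_Der: "pos_lie p D \<Longrightarrow> D \<in> Der A"
  using pos_lie_hdeg hdeg_Der by blast

lemma pos_lie_0: "2 \<le> p \<Longrightarrow> pos_lie p (\<lambda>a. 0)"
  using pos_lie.gen[of p 0] by (simp add: hcomp_zero subalg.zero vfield_0 cong: if_cong)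

lemma pos_lie_minus: "pos_lie p D \<Longrightarrow> pos_lie p (\<lambda>a. - D a)"
  using pos_lie.scale[of p D "-1"] by simp

lemma jacobi:
  assumes "E \<in> Der A" "D \<in> Der A" "F \<in> Der A"
  shows "(\<lambda>a. E (D (F a) - F (D a)) - (D (F (E a)) - F (D (E a)))) =
    (\<lambda>a. ((E (D (F a)) - D (E (F a))) - F (E (D a) - D (E a))) +
    (D (E (F a) - F (E a)) - (E (F (D a)) - F (E (D a)))))"
  by (simp add: linD[OF DerD(1)[OF assms(1)]] linD[OF DerD(1)[OF assms(2)]]
      linD[OF DerD(1)[OF assms(3)]] algebra_simps)

text \<open>For \<open>E\<close> in L_{-1} the bracket with f d_1 (d_1 the first partial derivation)
  is E(f) d_1, and E(f) still avoids x_1, because \<open>E\<close> sends generators to constants.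
  The Jacobi identity carries this through brackets. The bound on \<open>p\<close> excludes only
  degree 2, where the result lies in L_0.\<close>

lemma pos_lie_lower:
  assumes "pos_lie p D" "hdeg 0 E" "3 \<le> p"
  shows "pos_lie (p - 1) (\<lambda>a. E (D a) - D (E a))"
  using assms
proof (induction arbitrary: E rule: pos_lie.induct)
  case (gen p f)
  note E = hdeg_Der[OF gen.prems(1)]
  have "(\<lambda>a. E (vfield A n x (\<lambda>j. if j = 1 then f else 0) a) -
      vfield A n x (\<lambda>j. if j = 1 then f else 0) (E a)) =
    vfield A n x (\<lambda>j. if j = 1 then E f else 0)"
    by (rule vfield_eqI[symmetric])
      (simp_all add: Der_bracket E vfield_Der vfield_gen linD[OF DerD(1)[OF E]]
        Der_hcomp_0[OF vfield_Der hdeg_gen[OF gen.prems(1)]])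
  moreover have "E f \<in> subalg A (x ` {2..n})"
    by (rule Der_subalg[OF E _ gen.hyps(3)])
      (auto intro!: scale_unit_subalg hdeg_gen[OF gen.prems(1)])
  moreover have "E f \<in> HC (p - 1)"
    using hdeg_hcomp[OF gen.prems(1) gen.hyps(2)] gen.hyps(1) by simp
  ultimately show ?case
    using pos_lie.gen[of "p - 1" "E f"] gen.prems(2) by simp
next
  case (add p D F)
  then have "pos_lie (p - 1) (\<lambda>a. (E (D a) - D (E a)) + (E (F a) - F (E a)))"
    by (intro pos_lie.add)
  then show ?case
    using linD[OF DerD(1)[OF hdeg_Der[OF add.prems(1)]]] by (simp add: algebra_simps)
next
  case (scale p D c)
  then have "pos_lie (p - 1) (\<lambda>a. c \<cdot> (E (D a) - D (E a)))"
    by (intro pos_lie.scale)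
  then show ?case
    using linD[OF DerD(1)[OF hdeg_Der[OF scale.prems(1)]]] by (simp add: vs.scale_right_diff_distrib)
next
  case (linear p D F)
  \<comment> \<open>This commutator lies in L_{-1} again and takes the place of \<open>E\<close> in
    the induction hypothesis, which is why \<open>E\<close> is kept arbitrary.\<close>
  have "hdeg 0 (\<lambda>a. E (F a) - F (E a))"
    using hdeg_bracket[OF linear.prems(1) linear.hyps(2)] by simp
  then have "pos_lie (p - 1) (\<lambda>a. ((E (F (D a)) - F (E (D a))) - D (E (F a) - F (E a))) +
      (F (E (D a) - D (E a)) - (E (D (F a)) - D (E (F a)))))"
    by (intro pos_lie.add pos_lie.linear linear.IH linear.hyps linear.prems)
  then show ?case
    by (simp only: jacobi[OF hdeg_Der[OF linear.prems(1)] hdeg_Der[OF linear.hyps(2)]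
        pos_lie_Der[OF linear.hyps(1)]])
next
  case (bracket p D q F)
  note h = pos_lie_hdeg[OF bracket.hyps(1)] pos_lie_hdeg[OF bracket.hyps(2)]
  have "pos_lie (p + q - 1 - 1) (\<lambda>a. (E (D (F a)) - D (E (F a))) - F (E (D a) - D (E a)))"
  \<comment> \<open>A factor with \<open>p = 2\<close> is lowered into L_0, beyond the induction
    hypothesis; its bracket with the other factor is then an instance of the rule
    \<open>linear\<close>.\<close>
  proof (cases "p = 2")
    case True
    then have "hdeg 1 (\<lambda>a. E (D a) - D (E a))"
      using hdeg_bracket[OF bracket.prems(1), of p D] h by simp
    then show ?thesis using pos_lie.linear[OF bracket.hyps(2)] True by simp
  next
    case False
    then have low: "pos_lie (p - 1) (\<lambda>a. E (D a) - D (E a))"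
      using bracket.IH(1)[OF bracket.prems(1)] h by simp
    have eq: "p - 1 + q - 1 = p + q - 1 - 1" using h by simp
    show ?thesis using pos_lie.bracket[OF low bracket.hyps(2)] by (simp only: eq)
  qed
  moreover have "pos_lie (p + q - 1 - 1) (\<lambda>a. D (E (F a) - F (E a)) - (E (F (D a)) - F (E (D a))))"
  proof (cases "q = 2")
    case True
    then have "hdeg 1 (\<lambda>a. E (F a) - F (E a))"
      using hdeg_bracket[OF bracket.prems(1), of q F] h by simp
    from pos_lie_minus[OF pos_lie.linear[OF bracket.hyps(1) this]] show ?thesis using True by simp
  next
    case False
    then have low: "pos_lie (q - 1) (\<lambda>a. E (F a) - F (E a))"
      using bracket.IH(2)[OF bracket.prems(1)] h by simp
    have eq: "p + (q - 1) - 1 = p + q - 1 - 1" using h by simp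
    show ?thesis using pos_lie.bracket[OF bracket.hyps(1) low] by (simp only: eq)
  qed
  ultimately have "pos_lie (p + q - 1 - 1) (\<lambda>a.
      ((E (D (F a)) - D (E (F a))) - F (E (D a) - D (E a))) +
      (D (E (F a) - F (E a)) - (E (F (D a)) - F (E (D a)))))"
    by (rule pos_lie.add)
  then show ?case
    by (simp only: jacobi[OF hdeg_Der[OF bracket.prems(1)] pos_lie_Der[OF bracket.hyps(1)]
        pos_lie_Der[OF bracket.hyps(2)]])
qed

subsection \<open>Derivations tangent to tame automorphisms\<close>

text \<open>Demanding all scalar multiples at once makes this a subspace, since scalars can be moved into
  one factor of a bracket.\<close>

definition tame_tangent :: "nat \<Rightarrow> ('a \<Rightarrow> 'a) \<Rightarrow> bool" where
  "tame_tangent p D \<longleftrightarrow>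
    hdeg p D \<and> (\<forall>c. \<exists>\<phi>\<in>tame A n x. tangent (p - 1) \<phi> (\<lambda>a. c \<cdot> D a))"

lemma tame_tangentD:
  assumes "tame_tangent p D"
  obtains \<phi> where "\<phi> \<in> tame A n x" "tangent (p - 1) \<phi> (\<lambda>a. c \<cdot> D a)"
  using assms by (auto simp: tame_tangent_def)

lemma tame_tangent_hdeg: "tame_tangent p D \<Longrightarrow> hdeg p D"
  by (simp add: tame_tangent_def)

lemma tame_tangent_0: "tame_tangent p (\<lambda>a. 0)"
  by (auto simp: tame_tangent_def hdeg_0 tangent_def raises_0 intro!: bexI[of _ id] tame.one)

lemma tame_tangent_scale: "tame_tangent p D \<Longrightarrow> tame_tangent p (\<lambda>a. c \<cdot> D a)"
  by (auto simp: tame_tangent_def hdeg_scale)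

lemma tame_tangent_add:
  assumes "tame_tangent p D" "tame_tangent p E" "2 \<le> p"
  shows "tame_tangent p (\<lambda>a. D a + E a)"
  unfolding tame_tangent_def
proof (intro conjI allI)
  show "hdeg p (\<lambda>a. D a + E a)" using assms by (simp add: tame_tangent_hdeg hdeg_add)
  fix c
  obtain \<phi> where \<phi>: "\<phi> \<in> tame A n x" "tangent (p - 1) \<phi> (\<lambda>a. c \<cdot> D a)"
    using assms(1) by (rule tame_tangentD)
  obtain \<psi> where \<psi>: "\<psi> \<in> tame A n x" "tangent (p - 1) \<psi> (\<lambda>a. c \<cdot> E a)"
    using assms(2) by (rule tame_tangentD)
  have "tangent (p - 1) (\<phi> \<circ> \<psi>) (\<lambda>a. c \<cdot> (D a + E a))"
    using tangent_comp[OF _ \<phi>(2) \<psi>(2)] assms(3) by (simp add: vs.scale_right_distrib)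
  then show "\<exists>\<phi>\<in>tame A n x. tangent (p - 1) \<phi> (\<lambda>a. c \<cdot> (D a + E a))"
    using tame.comp[OF \<phi>(1) \<psi>(1)] by blast
qed

lemma tame_tangent_sum:
  assumes "finite I" "\<And>i. i \<in> I \<Longrightarrow> tame_tangent p (D i)" "2 \<le> p"
  shows "tame_tangent p (\<lambda>a. \<Sum>i\<in>I. D i a)"
  using assms(1,2)
  by (induction I rule: finite_induct) (auto intro!: tame_tangent_0 tame_tangent_add assms(3))

lemma raises_inv_tangent:
  assumes "\<phi> \<in> Aut A" "tangent k \<phi> D"
  shows "raises 0 (inv \<phi>)"
proof (rule raises_inv[OF assms(1)])
  fix i assume "i \<in> {1..n}"
  then have "x i \<in> TL 1" using hcomp_tail[OF gen_in_hcomp] by simp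
  then show "\<phi> (x i) \<in> TL 1" using raisesD[OF tangent_raises_0[OF assms(2)]] by fastforce
qed

lemma tame_tangent_bracket:
  assumes "tame_tangent p D" "tame_tangent q E" "2 \<le> p" "2 \<le> q"
  shows "tame_tangent (p + q - 1) (\<lambda>a. D (E a) - E (D a))"
  unfolding tame_tangent_def
proof (intro conjI allI)
  note hD = tame_tangent_hdeg[OF assms(1)] and hE = tame_tangent_hdeg[OF assms(2)]
  show "hdeg (p + q - 1) (\<lambda>a. D (E a) - E (D a))" using hD hE by (rule hdeg_bracket)
  fix c
  obtain \<phi> where \<phi>: "\<phi> \<in> tame A n x" "tangent (p - 1) \<phi> (\<lambda>a. c \<cdot> D a)"
    using assms(1) by (rule tame_tangentD)
  obtain \<psi> where "\<psi> \<in> tame A n x" "tangent (q - 1) \<psi> (\<lambda>a. 1 \<cdot> E a)"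
    using assms(2) by (rule tame_tangentD)
  then have \<psi>: "\<psi> \<in> tame A n x" "tangent (q - 1) \<psi> E" by simp_all
  note aut = tame_Aut[OF \<phi>(1)] tame_Aut[OF \<psi>(1)]
  have "tangent (p - 1 + (q - 1)) (\<phi> \<circ> \<psi> \<circ> inv \<phi> \<circ> inv \<psi>) (\<lambda>a. c \<cdot> D (E a) - E (c \<cdot> D a))"
    using assms(3,4) aut[THEN AutD(2)]
    by (intro tangent_commutator[OF _ _ \<phi>(2) \<psi>(2)] raises_inv_tangent[OF aut(1) \<phi>(2)]
        raises_inv_tangent[OF aut(2) \<psi>(2)]) auto
  moreover have "p - 1 + (q - 1) = p + q - 1 - 1" using assms(3,4) by simp
  ultimately have "tangent (p + q - 1 - 1) (\<phi> \<circ> \<psi> \<circ> inv \<phi> \<circ> inv \<psi>) (\<lambda>a. c \<cdot> (D (E a) - E (D a)))"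
    by (simp add: linD[OF DerD(1)[OF hdeg_Der[OF hE]]] vs.scale_right_diff_distrib)
  moreover have "\<phi> \<circ> \<psi> \<circ> inv \<phi> \<circ> inv \<psi> \<in> tame A n x"
    by (intro tame.comp tame.inverse \<phi> \<psi>)
  ultimately show "\<exists>\<phi>\<in>tame A n x. tangent (p + q - 1 - 1) \<phi> (\<lambda>a. c \<cdot> (D (E a) - E (D a)))"
    by blast
qed

lemma tame_tangent_gen:
  assumes "2 \<le> p" "f \<in> HC p" "f \<in> subalg A (x ` {2..n})" "1 \<le> n"
  shows "tame_tangent p (vfield A n x (\<lambda>j. if j = 1 then f else 0))"
  unfolding tame_tangent_def
proof (intro conjI allI)
  show "hdeg p (vfield A n x (\<lambda>j. if j = 1 then f else 0))"
    using assms by (simp add: hdeg_vfield hcomp_zero)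
  fix c
  have "{1..n} - {1} = {2..n}" by auto
  then have "c \<cdot> f \<in> subalg A (x ` ({1..n} - {1}))" using assms(3) by (simp add: subalg.scale)
  moreover have "1 \<in> {1..n}" using assms(4) by simp
  ultimately obtain \<phi> where
    \<phi>: "\<phi> \<in> elementary A n x" "\<phi> (x 1) = 1 \<cdot> x 1 + c \<cdot> f"
      "\<And>j. j \<in> {1..n} \<Longrightarrow> j \<noteq> 1 \<Longrightarrow> \<phi> (x j) = x j"
    using ex_elementary[OF _ one_neq_zero] by metis
  have "\<phi> \<in> Aut A" using \<phi>(1) by (simp add: elementary_def)
  have "tangent (p - 1) \<phi> (\<lambda>a. c \<cdot> vfield A n x (\<lambda>j. if j = 1 then f else 0) a)"
  proof (rule tangentI[OF AutD(1)[OF \<open>\<phi> \<in> Aut A\<close>] Der_scale[OF vfield_Der]])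
    show "1 \<le> p - 1" using assms(1) by simp
    fix i assume i: "i \<in> {1..n}"
    show "c \<cdot> vfield A n x (\<lambda>j. if j = 1 then f else 0) (x i) \<in> TL (p - 1 + 1)"
      using i assms(1) hcomp_tail[OF assms(2)] by (auto simp: vfield_gen tail_scale tail_zero)
    show "\<phi> (x i) - x i - c \<cdot> vfield A n x (\<lambda>j. if j = 1 then f else 0) (x i) \<in> TL (p - 1 + 2)"
      using \<phi>(2) \<phi>(3)[OF i] i by (cases "i = 1") (simp_all add: vfield_gen tail_zero)
  qed
  then show "\<exists>\<phi>\<in>tame A n x. tangent (p - 1) \<phi>
      (\<lambda>a. c \<cdot> vfield A n x (\<lambda>j. if j = 1 then f else 0) a)"
    using tame.gen[OF \<phi>(1)] by blast
qed

lemma hom_hcomp: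
  assumes "is_hom A A h" "\<And>i. i \<in> {1..n} \<Longrightarrow> h (x i) \<in> HC 1" "a \<in> HC m"
  shows "h a \<in> HC m"
proof (rule lin_image_hcomp[OF homD(1)[OF assms(1)] subspace_hcomp _ assms(3)])
  fix a assume "(m, a) \<in> monomials A n x"
  then show "h a \<in> HC m"
    using assms(2) by induction (simp_all add: homD[OF assms(1)] hcomp_mul unit_in_hcomp)
qed

lemma tame_tangent_conj:
  assumes "tame_tangent p D" and \<mu>: "\<mu> \<in> tame A n x"
    and x: "\<And>i. i \<in> {1..n} \<Longrightarrow> \<mu> (x i) \<in> HC 1" "\<And>i. i \<in> {1..n} \<Longrightarrow> inv \<mu> (x i) \<in> HC 1"
  shows "tame_tangent p (\<lambda>a. \<mu> (D (inv \<mu> a)))"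
  unfolding tame_tangent_def
proof (intro conjI allI)
  note D = tame_tangent_hdeg[OF assms(1)] and aut = tame_Aut[OF \<mu>]
  note homs = AutD(1)[OF aut] AutD(1)[OF Aut_inv[OF aut]]
  have "\<mu> (D (inv \<mu> (x i))) \<in> HC p" if "i \<in> {1..n}" for i
    using hdeg_hcomp[OF D x(2)[OF that]] by (intro hom_hcomp[OF homs(1) x(1)]) simp_all
  then show "hdeg p (\<lambda>a. \<mu> (D (inv \<mu> a)))"
    by (simp add: hdeg_def Der_conj[OF hdeg_Der[OF D] aut])
  fix c
  obtain \<phi> where \<phi>: "\<phi> \<in> tame A n x" "tangent (p - 1) \<phi> (\<lambda>a. c \<cdot> D a)"
    using assms(1) by (rule tame_tangentD)
  have "tangent (p - 1) (\<mu> \<circ> \<phi> \<circ> inv \<mu>) (\<lambda>a. \<mu> (c \<cdot> D (inv \<mu> a)))"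
    by (rule tangent_conj[OF \<phi>(2) raises_hom[OF homs(1) hcomp_tail[OF x(1)]]
        raises_hom[OF homs(2) hcomp_tail[OF x(2)]]])
      (simp_all add: Aut_inv_apply[OF aut])
  then have "tangent (p - 1) (\<mu> \<circ> \<phi> \<circ> inv \<mu>) (\<lambda>a. c \<cdot> \<mu> (D (inv \<mu> a)))"
    by (simp add: linD[OF homD(1)[OF homs(1)]])
  then show "\<exists>\<phi>\<in>tame A n x. tangent (p - 1) \<phi> (\<lambda>a. c \<cdot> \<mu> (D (inv \<mu> a)))"
    using \<phi>(1) \<mu> by (blast intro: tame.comp tame.inverse)
qed

lemma subalg_lincomb: "finite I \<Longrightarrow> (\<Sum>i\<in>I. c i \<cdot> x i) \<in> subalg A (x ` I)"
  by (intro subalg_sum subalg.scale subalg.gen) auto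

text \<open>Conjugating \<open>D\<close> by \<open>\<mu>\<^sub>t: x\<^sub>i \<mapsto> x\<^sub>i + t g\<close> gives tangents of tame automorphisms. If \<open>b\<close> is the
  coefficient of \<open>x\<^sub>i\<close> in \<open>g\<close>, then \<open>(1 + t b) \<mu>\<^sub>t D \<mu>\<^sub>t\<^sup>-\<^sup>1\<close> is polynomial in \<open>t\<close> with linear
  coefficient \<open>[E, D] + b D\<close>.\<close>

lemma tame_tangent_linear_single:
  assumes "tame_tangent p D" "2 \<le> p" and i: "i \<in> {1..n}" and g: "g \<in> HC 1"
  defines "E \<equiv> vfield A n x (\<lambda>j. if j = i then g else 0)"
  shows "tame_tangent p (\<lambda>a. E (D a) - D (E a))"
proof -
  note D = tame_tangent_hdeg[OF assms(1)]
  note DD = hdeg_Der[OF D]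
  note linDD = linD[OF DerD(1)[OF DD]]
  obtain d where d: "g = (\<Sum>l=1..n. d l \<cdot> x l)" using hcomp_1[OF g] by blast
  define b where "b = d i"
  define g' where "g' = (\<Sum>l\<in>{1..n} - {i}. d l \<cdot> x l)"
  have g_eq: "g = b \<cdot> x i + g'"
    unfolding d b_def g'_def using i by (simp add: sum.remove)
  have g'_in: "g' \<in> subalg A (x ` ({1..n} - {i}))"
    unfolding g'_def by (rule subalg_lincomb) simp
  have g'_hc: "g' \<in> HC 1"
    unfolding g'_def by (intro hcomp_sum hcomp_scale gen_in_hcomp) simp
  obtain H where H: "is_hom A polyalg H"
    "\<And>j. j \<in> {1..n} \<Longrightarrow> H (x j) = [:x j, if j = i then g else 0:]"
    "\<And>a. coeff (H a) 0 = a" "\<And>a. coeff (H a) 1 = E a"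
    unfolding E_def using ex_flow[of "\<lambda>j. if j = i then g else 0"] by metis
  \<comment> \<open>The inverse of \<open>\<mu>\<close> sends x_i to (x_i - t g')/(1 + t b), and x_i
    - t g' = (1 + t b) x_i - t g. Multiplying by 1 + t b thus clears the denominator;
    \<open>P j\<close> is the resulting value at x_j as a polynomial in t.\<close>
  define P where "P j = H (D (x j)) + pCons 0 (psc b (H (D (x j)))) +
    (if j = i then pCons 0 (psc (-1) (H (D g))) else 0)" for j
  have W: "(\<lambda>j. ev t (P j)) \<in> {f. tame_tangent p (vfield A n x f)}" if s: "1 + t * b \<noteq> 0" for t
  proof -
    define s where "s = 1 + t * b"
    have "s \<noteq> 0" using s by (simp add: s_def)
    from ex_elementary[OF i this subalg.scale[OF g'_in]] obtain \<mu> where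
      \<mu>: "\<mu> \<in> elementary A n x" "\<mu> (x i) = s \<cdot> x i + t \<cdot> g'"
      "\<And>j. j \<in> {1..n} \<Longrightarrow> j \<noteq> i \<Longrightarrow> \<mu> (x j) = x j"
      "inv \<mu> (x i) = inverse s \<cdot> (x i - t \<cdot> g')"
      "\<And>j. j \<in> {1..n} \<Longrightarrow> j \<noteq> i \<Longrightarrow> inv \<mu> (x j) = x j" by metis
    have aut: "\<mu> \<in> Aut A" using \<mu>(1) by (simp add: elementary_def)
    note lin\<mu> = linD[OF homD(1)[OF AutD(1)[OF aut]]]
    have ev0: "ev t 0 = 0" by (simp add: ev_def)
    have "\<mu> = (\<lambda>a. ev t (H a))"
    proof (rule is_hom_unique[OF AutD(1)[OF aut] is_hom_ev_comp[OF H(1)]])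
      fix j assume "j \<in> {1..n}"
      then show "\<mu> (x j) = ev t (H (x j))"
        using \<mu>(2,3) H(2)
        by (cases "j = i") (simp_all add: ev_pCons ev0 s_def g_eq vs.scale_left_distrib
            vs.scale_right_distrib add.assoc del: pCons_eq_0_iff)
    qed
    then have evH: "ev t (H a) = \<mu> a" for a by simp
    have hc: "\<mu> (x j) \<in> HC 1" "inv \<mu> (x j) \<in> HC 1" if "j \<in> {1..n}" for j
      using that \<mu>(2-5) g'_hc gen_in_hcomp[OF that]
      by (cases "j = i"; simp add: hcomp_add hcomp_scale hcomp_diff)+
    have "tame_tangent p (\<lambda>a. s \<cdot> \<mu> (D (inv \<mu> a)))"
      by (intro tame_tangent_scale tame_tangent_conj assms(1) tame.gen \<mu>(1) hc)
    moreover have "vfield A n x (\<lambda>j. ev t (P j)) = (\<lambda>a. s \<cdot> \<mu> (D (inv \<mu> a)))"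
    proof (rule vfield_eqI[OF Der_scale[OF Der_conj[OF DD aut]]])
      fix j assume j: "j \<in> {1..n}"
      have evP: "ev t (P j) = s \<cdot> \<mu> (D (x j)) + (if j = i then - (t \<cdot> \<mu> (D g)) else 0)"
        by (simp add: P_def ev_add ev_pCons ev_psc evH ev0 s_def vs.scale_left_distrib)
      show "ev t (P j) = s \<cdot> \<mu> (D (inv \<mu> (x j)))"
      proof (cases "j = i")
        case True
        have "s \<cdot> inv \<mu> (x i) = x i - t \<cdot> g'"
          using \<open>s \<noteq> 0\<close> by (simp add: \<mu>(4))
        also have "\<dots> = s \<cdot> x i - t \<cdot> g"
          by (simp add: g_eq s_def vs.scale_left_distrib vs.scale_right_distrib)
        finally have "s \<cdot> \<mu> (D (inv \<mu> (x i))) = s \<cdot> \<mu> (D (x i)) - t \<cdot> \<mu> (D g)"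
          by (metis lin\<mu>(2,5) linDD(2,5))
        then show ?thesis using True evP by simp
      next
        case False
        then show ?thesis using \<mu>(5) j by (simp add: evP)
      qed
    qed
    ultimately show ?thesis by simp
  qed
  \<comment> \<open>A common degree bound for the \<open>P j\<close> with j in range;
    \<open>Suc\<close> makes the coefficient index 1 admissible.\<close>
  define M where "M = Suc (\<Sum>j=1..n. degree (P j))"
  have M: "degree (P j) \<le> M" if "j \<in> {1..n}" for j
    using member_le_sum[OF that, of "\<lambda>j. degree (P j)"] by (simp add: M_def)
  \<comment> \<open>The sample points 2^l c must avoid -1/b. For c = 1/b the condition becomes 1 +
    2^l \<noteq> 0, true in characteristic zero.\<close>
  define c where "c = (if b = 0 then 1 else inverse b)"
  have nz: "1 + 2 ^ l * c * b \<noteq> 0" for l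
  proof (cases "b = 0")
    case False
    have "(of_nat (1 + 2 ^ l) :: 'k) \<noteq> 0" by (simp only: of_nat_eq_0_iff add_is_0 one_neq_zero simp_thms)
    then show ?thesis using False by (simp add: c_def mult.assoc)
  qed simp
  have "(\<lambda>j. coeff (P j) 1) \<in> {f. tame_tangent p (vfield A n x f)}"
  proof (rule coeffs_of_values[where m = M and c = c and v = "\<lambda>i j. coeff (P j) i"])
    show "c \<noteq> 0" by (simp add: c_def)
    show "1 \<le> M" by (simp add: M_def)
    fix l
    \<comment> \<open>Outside 1..n the bound \<open>M\<close> need not hold, but
      \<open>vfield\<close> depends only on the values at indices in that range.\<close>
    have "vfield A n x (\<lambda>j. \<Sum>i\<le>M. (2 ^ l * c) ^ i \<cdot> coeff (P j) i) =
        vfield A n x (\<lambda>j. ev (2 ^ l * c) (P j))"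
      by (rule vfield_eqI[OF vfield_Der]) (simp only: vfield_gen ev_eq_sum[OF M])
    then show "(\<lambda>j. \<Sum>i\<le>M. (2 ^ l * c) ^ i \<cdot> coeff (P j) i) \<in> {f. tame_tangent p (vfield A n x f)}"
      using W[OF nz] by simp
  qed (auto simp: vfield_0 vfield_add vfield_scale assms(2)
      intro: tame_tangent_0 tame_tangent_add tame_tangent_scale)
  then have "tame_tangent p (\<lambda>a. vfield A n x (\<lambda>j. coeff (P j) 1) a + (- b) \<cdot> D a)"
    by (intro tame_tangent_add tame_tangent_scale assms(1,2)) simp
  moreover have "(\<lambda>a. vfield A n x (\<lambda>j. coeff (P j) 1) a + (- b) \<cdot> D a) = (\<lambda>a. E (D a) - D (E a))"
  proof (rule Der_unique)
    show "(\<lambda>a. vfield A n x (\<lambda>j. coeff (P j) 1) a + (- b) \<cdot> D a) \<in> Der A"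
      by (intro Der_add Der_scale vfield_Der DD)
    show "(\<lambda>a. E (D a) - D (E a)) \<in> Der A"
      unfolding E_def by (intro Der_bracket vfield_Der DD)
    fix j assume j: "j \<in> {1..n}"
    have "coeff (P j) 1 = E (D (x j)) + b \<cdot> D (x j) - (if j = i then D g else 0)"
      by (simp add: P_def H(3) H(4)[simplified])
    moreover have "E (x j) = (if j = i then g else 0)" using j by (simp add: E_def vfield_gen)
    ultimately show "vfield A n x (\<lambda>j. coeff (P j) 1) (x j) + (- b) \<cdot> D (x j) = E (D (x j)) - D (E (x j))"
      using j by (simp add: vfield_gen linDD)
  qed
  ultimately show ?thesis by simp
qed

text \<open>Every element of L_0 is the sum of its single-generator parts E(x_i) d_i, each covered
  by \<open>tame_tangent_linear_single\<close>.\<close>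

lemma tame_tangent_linear:
  assumes "tame_tangent p D" "2 \<le> p" "hdeg 1 E"
  shows "tame_tangent p (\<lambda>a. E (D a) - D (E a))"
proof -
  define F where "F i = vfield A n x (\<lambda>j. if j = i then E (x i) else 0)" for i
  have "E = (\<lambda>a. \<Sum>i=1..n. F i a)"
  proof (rule Der_unique[OF hdeg_Der[OF assms(3)]])
    show "(\<lambda>a. \<Sum>i=1..n. F i a) \<in> Der A" unfolding F_def by (intro Der_sum vfield_Der)
    fix j assume "j \<in> {1..n}"
    then show "E (x j) = (\<Sum>i=1..n. F i (x j))" by (simp add: F_def vfield_gen)
  qed
  then have E: "E a = (\<Sum>i=1..n. F i a)" for a by metis
  have "tame_tangent p (\<lambda>a. \<Sum>i=1..n. F i (D a) - D (F i a))"
    unfolding F_def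
    by (intro tame_tangent_sum tame_tangent_linear_single assms(1,2) hdeg_gen[OF assms(3)]) auto
  then show ?thesis
    by (simp add: E sum_subtractf linD[OF DerD(1)[OF hdeg_Der[OF tame_tangent_hdeg[OF assms(1)]]]])
qed

lemma pos_lie_tame_tangent:
  assumes "pos_lie p D" "1 \<le> n" shows "tame_tangent p D"
  using assms(1)
proof induction
  case (gen p f)
  then show ?case using assms(2) by (intro tame_tangent_gen)
next
  case (bracket p D q E)
  then show ?case using pos_lie_hdeg by (intro tame_tangent_bracket) auto
qed (use pos_lie_hdeg in \<open>auto intro: tame_tangent_add tame_tangent_scale tame_tangent_linear\<close>)

subsection \<open>The Lie algebra generated in the hypothesis\<close>

inductive graded_lie :: "('a \<Rightarrow> 'a) \<Rightarrow> bool" where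
  low: "hdeg p D \<Longrightarrow> p \<le> 1 \<Longrightarrow> graded_lie D"
| high: "pos_lie p D \<Longrightarrow> graded_lie D"
| add: "graded_lie D \<Longrightarrow> graded_lie E \<Longrightarrow> graded_lie (\<lambda>a. D a + E a)"

lemma graded_lie_Der: "graded_lie D \<Longrightarrow> D \<in> Der A"
  by (induction rule: graded_lie.induct) (auto simp: hdeg_Der pos_lie_Der Der_add)

lemma graded_lie_scale: "graded_lie D \<Longrightarrow> graded_lie (\<lambda>a. c \<cdot> D a)"
proof (induction rule: graded_lie.induct)
  case (low p D)
  then show ?case by (intro graded_lie.low[of p] hdeg_scale)
next
  case (high p D)
  then show ?case by (intro graded_lie.high[of p] pos_lie.scale)
next
  case (add D E)
  then show ?case using graded_lie.add[OF add.IH] by (simp add: vs.scale_right_distrib)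
qed

lemma graded_lie_minus: "graded_lie (\<lambda>a. D (E a) - E (D a)) \<Longrightarrow> graded_lie (\<lambda>a. E (D a) - D (E a))"
  using graded_lie_scale[of "\<lambda>a. D (E a) - E (D a)" "-1"] by simp

lemma low_bracket_low:
  assumes "hdeg p D" "p \<le> 1" "hdeg q E" "q \<le> 1"
  shows "graded_lie (\<lambda>a. D (E a) - E (D a))"
  using hdeg_bracket[OF assms(1,3)] by (rule graded_lie.low) (use assms in simp)

text \<open>The degree left out by \<open>pos_lie_lower\<close> is harmless here: L_{-1} sends it
  into L_0, all of which belongs to \<open>graded_lie\<close>.\<close>

lemma low_bracket_high:
  assumes "hdeg p D" "p \<le> 1" "pos_lie q E"
  shows "graded_lie (\<lambda>a. D (E a) - E (D a))"
proof (cases "p = 1")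
  case True
  then show ?thesis using assms by (intro graded_lie.high[of q] pos_lie.linear) simp_all
next
  case False
  then have D: "hdeg 0 D" using assms by (cases p) auto
  show ?thesis
  proof (cases "q = 2")
    case True
    then show ?thesis
      using hdeg_bracket[OF D, of q E] pos_lie_hdeg[OF assms(3)] by (intro graded_lie.low[of 1]) simp_all
  next
    case False
    then have "3 \<le> q" using pos_lie_hdeg[OF assms(3)] by simp
    with assms(3) D show ?thesis by (intro graded_lie.high[OF pos_lie_lower])
  qed
qed

lemma bracket_add_right:
  assumes "D \<in> Der A" "graded_lie (\<lambda>a. D (E a) - E (D a))" "graded_lie (\<lambda>a. D (F a) - F (D a))"
  shows "graded_lie (\<lambda>a. D (E a + F a) - (E (D a) + F (D a)))"
  using graded_lie.add[OF assms(2,3)] by (simp add: linD[OF DerD(1)[OF assms(1)]] algebra_simps)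

lemma low_bracket:
  assumes "hdeg p D" "p \<le> 1" "graded_lie E"
  shows "graded_lie (\<lambda>a. D (E a) - E (D a))"
  using assms(3)
proof induction
  case (low q E)
  then show ?case using low_bracket_low[OF assms(1,2)] by blast
next
  case (high q E)
  then show ?case using low_bracket_high[OF assms(1,2)] by blast
next
  case (add E F)
  then show ?case using bracket_add_right[OF hdeg_Der[OF assms(1)]] by blast
qed

lemma high_bracket:
  assumes "pos_lie p D" "graded_lie E"
  shows "graded_lie (\<lambda>a. D (E a) - E (D a))"
  using assms(2)
proof induction
  case (low q E)
  then show ?case using graded_lie_minus low_bracket_high assms(1) by blast
next
  case (high q E)
  then show ?case using graded_lie.high pos_lie.bracket assms(1) by blast
next
  case (add E F)
  then show ?case using bracket_add_right[OF pos_lie_Der[OF assms(1)]] by blast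
qed

lemma graded_lie_bracket:
  assumes "graded_lie D" "graded_lie E"
  shows "graded_lie (\<lambda>a. D (E a) - E (D a))"
  using assms(1)
proof induction
  case (low p D)
  then show ?case using low_bracket assms(2) by blast
next
  case (high p D)
  then show ?case using high_bracket assms(2) by blast
next
  case (add D F)
  show ?case
    by (rule graded_lie_minus, rule bracket_add_right[OF graded_lie_Der[OF assms(2)]])
      (rule graded_lie_minus, fact)+
qed

lemma lie_gen_graded_lie:
  assumes "D \<in> lie_gen A (der_comp A n x (-1) \<union> der_comp A n x 0 \<union>
    {vfield A n x (\<lambda>j. if j = 1 then f else 0) | f d.
       d \<ge> 2 \<and> f \<in> hcomp A n x d \<and> f \<in> subalg A (x ` {2..n})})"
  shows "graded_lie D"
  using assms
proof induction
  case (gen D)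
  then consider "hdeg 0 D" | "hdeg 1 D" | p where "pos_lie p D"
    by (auto simp: hdeg_iff_der_comp simp del: One_nat_def intro: pos_lie.gen)
  then show ?case by cases (auto intro: graded_lie.low graded_lie.high)
next
  case zero
  show ?case by (rule graded_lie.low[OF hdeg_0[of 0]]) simp
next
  case (bracket D E)
  show ?case by (rule graded_lie_bracket) fact+
qed (auto intro: graded_lie.add graded_lie_scale)

text \<open>This returns from the generated algebra to one degree: summands of other degrees project
  to zero, so a homogeneous element of degree at least 2 is built by the rules of
  \<open>pos_lie\<close> alone.\<close>

lemma graded_lie_component:
  assumes "graded_lie D" "2 \<le> p"
  shows "pos_lie p (vfield A n x (\<lambda>j. prj p (D (x j))))"
  using assms(1)
proof induction
  case (low q D)
  have "vfield A n x (\<lambda>j. prj p (D (x j))) = (\<lambda>a. 0)"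
    using low assms(2) by (intro vfield_eqI Der_0) (auto simp: prj_hcomp[OF hdeg_gen])
  then show ?case using pos_lie_0[OF assms(2)] by simp
next
  case (high q D)
  have D: "hdeg q D" using pos_lie_hdeg[OF high] by simp
  show ?case
  proof (cases "p = q")
    case True
    then have "vfield A n x (\<lambda>j. prj p (D (x j))) = D"
      using D by (intro vfield_eqI hdeg_Der) (auto simp: prj_hcomp[OF hdeg_gen])
    then show ?thesis using high True by simp
  next
    case False
    then have "vfield A n x (\<lambda>j. prj p (D (x j))) = (\<lambda>a. 0)"
      using D by (intro vfield_eqI Der_0) (auto simp: prj_hcomp[OF hdeg_gen])
    then show ?thesis using pos_lie_0[OF assms(2)] by simp
  qed
next
  case (add D E)
  then show ?case by (simp add: prj_lin vfield_add pos_lie.add)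
qed

subsection \<open>Reduction to \<open>IA(1)\<close>\<close>

lemma gen_in_tail: "i \<in> {1..n} \<Longrightarrow> x i \<in> TL 1"
  using hcomp_tail[OF gen_in_hcomp] by simp

lemma hom_fixes_hcomp_0: "is_hom A A h \<Longrightarrow> a \<in> HC 0 \<Longrightarrow> h a = a"
  using hcomp_0[of a] by (auto simp: homD linD[OF homD(1)])

text \<open>Since automorphisms fix constants, precomposing with x_j to x_j - c lowers the constant
  term of the image of x_j by exactly c.\<close>

lemma tame_kills_constants:
  assumes \<phi>: "\<phi> \<in> Aut A"
  shows "\<exists>\<tau>\<in>tame A n x. \<forall>j\<in>{1..n}. \<phi> (\<tau> (x j)) \<in> TL 1"
proof -
  have "\<exists>\<tau>\<in>tame A n x. \<forall>j\<in>{1..n}. j \<le> m \<longrightarrow> \<phi> (\<tau> (x j)) \<in> TL 1" for m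
  proof (induction m)
    case 0
    then show ?case by (intro bexI[of _ id] tame.one) auto
  next
    case (Suc m)
    then obtain \<tau> where \<tau>: "\<tau> \<in> tame A n x"
      and \<tau>x: "\<And>j. j \<in> {1..n} \<Longrightarrow> j \<le> m \<Longrightarrow> \<phi> (\<tau> (x j)) \<in> TL 1" by blast
    show ?case
    proof (cases "Suc m \<in> {1..n}")
      case False
      then show ?thesis using \<tau> \<tau>x by (intro bexI[of _ \<tau>]) (auto simp: le_Suc_eq)
    next
      case True
      define c where "c = prj 0 (\<phi> (\<tau> (x (Suc m))))"
      have c: "c \<in> HC 0" by (simp add: c_def prj_in_hcomp)
      obtain \<sigma> where \<sigma>: "\<sigma> \<in> elementary A n x" "\<sigma> (x (Suc m)) = 1 \<cdot> x (Suc m) + - c"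
        "\<And>j. j \<in> {1..n} \<Longrightarrow> j \<noteq> Suc m \<Longrightarrow> \<sigma> (x j) = x j"
        using ex_elementary[OF True one_neq_zero scale_unit_subalg[OF hcomp_neg[OF c]]] by metis
      have aut: "\<phi> \<circ> \<tau> \<in> Aut A" by (intro Aut_comp \<phi> tame_Aut \<tau>)
      have "(\<phi> \<circ> \<tau>) (\<sigma> (x (Suc m))) = (\<phi> \<circ> \<tau>) (x (Suc m)) - c"
        using hom_fixes_hcomp_0[OF AutD(1)[OF aut] c]
        by (simp only: \<sigma>(2) linD[OF homD(1)[OF AutD(1)[OF aut]]] vs.scale_one) simp
      then have "\<phi> (\<tau> (\<sigma> (x (Suc m)))) \<in> TL 1"
        using prj_hcomp[OF c] by (simp add: tail_iff prj_lin c_def)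
      then have "\<phi> ((\<tau> \<circ> \<sigma>) (x j)) \<in> TL 1" if "j \<in> {1..n}" "j \<le> Suc m" for j
        using \<tau>x[OF that(1)] \<sigma>(3)[OF that(1)] that by (cases "j = Suc m") auto
      then show ?thesis using tame.comp[OF \<tau> tame.gen[OF \<sigma>(1)]] by blast
    qed
  qed
  from this[of n] show ?thesis by fastforce
qed

lemma hcomp_tail_zero: "a \<in> HC k \<Longrightarrow> a \<in> TL (Suc k) \<Longrightarrow> a = 0"
  using prj_hcomp[of a k k] by (simp add: tail_iff)

text \<open>If \<open>\<phi>\<^sup>-\<^sup>1(x\<^sub>q)\<close> involves \<open>x\<^sub>q\<close> linearly, the elementary automorphism sending \<open>x\<^sub>q\<close> to the linear
  part of \<open>\<phi>\<^sup>-\<^sup>1(x\<^sub>q)\<close> turns \<open>\<phi>(x\<^sub>q)\<close> into \<open>x\<^sub>q\<close> up to higher terms.\<close>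

lemma elimination_step:
  assumes \<phi>: "\<phi> \<in> Aut A" "\<And>j. j \<in> {1..n} \<Longrightarrow> \<phi> (x j) \<in> TL 1"
    and q: "q \<in> {1..n}" "d q \<noteq> 0" "inv \<phi> (x q) - (\<Sum>i=1..n. d i \<cdot> x i) \<in> TL 2"
  obtains \<tau> where "\<tau> \<in> tame A n x" "\<phi> (\<tau> (x q)) - x q \<in> TL 2"
    "\<And>j. j \<in> {1..n} \<Longrightarrow> j \<noteq> q \<Longrightarrow> \<tau> (x j) = x j"
proof -
  have sub: "(\<Sum>i\<in>{1..n} - {q}. d i \<cdot> x i) \<in> subalg A (x ` ({1..n} - {q}))"
    by (rule subalg_lincomb) simp
  obtain \<tau> where \<tau>: "\<tau> \<in> elementary A n x" "\<tau> (x q) = d q \<cdot> x q + (\<Sum>i\<in>{1..n} - {q}. d i \<cdot> x i)"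
    "\<And>j. j \<in> {1..n} \<Longrightarrow> j \<noteq> q \<Longrightarrow> \<tau> (x j) = x j"
    using ex_elementary[OF q(1,2) sub] by metis
  have "\<tau> (x q) = (\<Sum>i=1..n. d i \<cdot> x i)"
    unfolding \<tau>(2) using q(1) by (simp add: sum.remove)
  moreover have "\<phi> (inv \<phi> (x q) - (\<Sum>i=1..n. d i \<cdot> x i)) \<in> TL 2"
    using raisesD[OF raises_hom[OF AutD(1)[OF \<phi>(1)] \<phi>(2)] q(3)] by simp
  ultimately have "x q - \<phi> (\<tau> (x q)) \<in> TL 2"
    by (simp add: linD(5)[OF homD(1)[OF AutD(1)[OF \<phi>(1)]]] Aut_inv_apply[OF \<phi>(1)])
  from tail_neg[OF this] have "\<phi> (\<tau> (x q)) - x q \<in> TL 2" by simp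
  then show thesis using that tame.gen[OF \<tau>(1)] \<tau>(3) by blast
qed

text \<open>Pivoting on the row of \<open>inv \<phi> (x q)\<close>: a nonzero entry at q is used at
  once, and one at some i < q is first carried to position q. Only x_q and such an x_i are altered,
  so the normalized generators beyond q stay normalized.\<close>

lemma elimination:
  assumes \<phi>: "\<phi> \<in> Aut A" "\<And>j. j \<in> {1..n} \<Longrightarrow> \<phi> (x j) \<in> TL 1"
    and q: "q \<in> {1..n}" and above: "\<And>j. j \<in> {1..n} \<Longrightarrow> q < j \<Longrightarrow> \<phi> (x j) - x j \<in> TL 2"
  shows "\<exists>\<tau>\<in>tame A n x. (\<forall>j\<in>{1..n}. \<phi> (\<tau> (x j)) \<in> TL 1) \<and>
    (\<forall>j\<in>{1..n}. q \<le> j \<longrightarrow> \<phi> (\<tau> (x j)) - x j \<in> TL 2)"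
proof -
  note hom\<phi> = AutD(1)[OF \<phi>(1)]
  note lin\<phi> = linD[OF homD(1)[OF hom\<phi>]]
  define b where "b = inv \<phi> (x q)"
  have b: "b \<in> TL 1"
    using raisesD[OF raises_inv[OF \<phi>] gen_in_tail[OF q]] by (simp add: b_def)
  obtain d where d: "prj 1 b = (\<Sum>i=1..n. d i \<cdot> x i)" using hcomp_1[OF prj_in_hcomp] by blast
  have "b - prj 1 b \<in> TL 2"
    using b by (auto simp: tail_iff prj_lin prj_hcomp[OF prj_in_hcomp] less_Suc_eq numeral_2_eq_2)
  then have bd: "inv \<phi> (x q) - (\<Sum>i=1..n. d i \<cdot> x i) \<in> TL 2" unfolding d unfolding b_def .
  have finish: ?thesis if \<tau>: "\<tau> \<in> tame A n x" "\<phi> (\<tau> (x q)) - x q \<in> TL 2"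
    "\<And>j. j \<in> {1..n} \<Longrightarrow> j \<noteq> q \<Longrightarrow> \<phi> (\<tau> (x j)) \<in> TL 1"
    "\<And>j. j \<in> {1..n} \<Longrightarrow> q < j \<Longrightarrow> \<phi> (\<tau> (x j)) = \<phi> (x j)" for \<tau>
  proof -
    have "(\<phi> (\<tau> (x q)) - x q) + x q \<in> TL 1"
      by (rule tail_add[OF tail_mono[OF \<tau>(2)] gen_in_tail[OF q]]) simp
    then have "\<phi> (\<tau> (x j)) \<in> TL 1" if "j \<in> {1..n}" for j
      using \<tau>(3)[OF that] by (cases "j = q") auto
    moreover have "\<phi> (\<tau> (x j)) - x j \<in> TL 2" if "j \<in> {1..n}" "q \<le> j" for j
      using \<tau>(2,4) above that by (cases "j = q") auto
    ultimately show ?thesis using \<tau>(1) by blast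
  qed
  consider "d q \<noteq> 0" | i where "i \<in> {1..n}" "i < q" "d i \<noteq> 0" "d q = 0"
    | "\<And>i. i \<in> {1..n} \<Longrightarrow> i \<le> q \<Longrightarrow> d i = 0"
    by (metis le_neq_implies_less)
  then show ?thesis
  proof cases
    case 1
    from elimination_step[OF \<phi> q 1 bd] obtain \<tau> where
      "\<tau> \<in> tame A n x" "\<phi> (\<tau> (x q)) - x q \<in> TL 2"
      "\<And>j. j \<in> {1..n} \<Longrightarrow> j \<noteq> q \<Longrightarrow> \<tau> (x j) = x j" by blast
    then show ?thesis using \<phi>(2) by (intro finish[of \<tau>]) auto
  next
    case (2 i)
    have "x q \<in> subalg A (x ` ({1..n} - {i}))" using q 2 by (auto intro: subalg.gen)
    then have "(-1) \<cdot> x q \<in> subalg A (x ` ({1..n} - {i}))" by (rule subalg.scale)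
    \<comment> \<open>\<open>\<sigma>\<close> sends x_i to x_i - x_q, so its inverse sends x_i to
      x_i + x_q and puts the coefficient \<open>d i\<close> on x_q, where there was none.\<close>
    from ex_elementary[OF 2(1) one_neq_zero this] obtain \<sigma> where \<sigma>: "\<sigma> \<in> elementary A n x"
      "\<sigma> (x i) = 1 \<cdot> x i + (-1) \<cdot> x q" "\<And>j. j \<in> {1..n} \<Longrightarrow> j \<noteq> i \<Longrightarrow> \<sigma> (x j) = x j"
      "inv \<sigma> (x i) = inverse 1 \<cdot> (x i - (-1) \<cdot> x q)"
      "\<And>j. j \<in> {1..n} \<Longrightarrow> j \<noteq> i \<Longrightarrow> inv \<sigma> (x j) = x j" by metis
    have aut\<sigma>: "\<sigma> \<in> Aut A" using \<sigma>(1) by (simp add: elementary_def)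
    note hom\<sigma> = AutD(1)[OF Aut_inv[OF aut\<sigma>]]
    define \<psi> where "\<psi> = \<phi> \<circ> \<sigma>"
    have \<psi>: "\<psi> \<in> Aut A" unfolding \<psi>_def by (intro Aut_comp \<phi>(1) aut\<sigma>)
    have \<psi>x: "\<psi> (x j) \<in> TL 1" if "j \<in> {1..n}" for j
      using that \<sigma>(2,3) \<phi>(2)[OF that] \<phi>(2)[OF q]
      by (cases "j = i") (auto simp: \<psi>_def lin\<phi> intro: tail_diff)
    have inv\<psi>: "inv \<psi> a = inv \<sigma> (inv \<phi> a)" for a
      using o_inv_distrib[OF AutD(2)[OF \<phi>(1)] AutD(2)[OF aut\<sigma>]] by (simp add: \<psi>_def fun_eq_iff)
    have "inv \<sigma> (x j) \<in> TL 1" if "j \<in> {1..n}" for j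
      using that \<sigma>(4,5) gen_in_tail[OF that] gen_in_tail[OF q]
      by (cases "j = i") (auto intro: tail_add)
    from raisesD[OF raises_hom[OF hom\<sigma> this] bd]
    have "inv \<psi> (x q) - (\<Sum>l=1..n. d l \<cdot> inv \<sigma> (x l)) \<in> TL 2"
      by (simp add: inv\<psi> linD[OF homD(1)[OF hom\<sigma>]])
    moreover have "(\<Sum>l=1..n. d l \<cdot> inv \<sigma> (x l)) = (\<Sum>l=1..n. (if l = q then d i else d l) \<cdot> x l)"
    proof -
      have "(\<Sum>l=1..n. d l \<cdot> inv \<sigma> (x l)) = (\<Sum>l=1..n. d l \<cdot> x l + (if l = i then d i \<cdot> x q else 0))"
        by (rule sum.cong) (auto simp: \<sigma>(4,5) vs.scale_right_distrib)
      also have "\<dots> = (\<Sum>l=1..n. d l \<cdot> x l + (if l = q then d i \<cdot> x q else 0))"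
        using 2(1) q by (simp add: sum.distrib)
      also have "\<dots> = (\<Sum>l=1..n. (if l = q then d i else d l) \<cdot> x l)"
        by (rule sum.cong) (auto simp: 2(4))
      finally show ?thesis .
    qed
    ultimately have "inv \<psi> (x q) - (\<Sum>l=1..n. (if l = q then d i else d l) \<cdot> x l) \<in> TL 2" by simp
    from elimination_step[OF \<psi> \<psi>x q _ this] 2(3) obtain \<tau> where \<tau>: "\<tau> \<in> tame A n x"
      "\<psi> (\<tau> (x q)) - x q \<in> TL 2" "\<And>j. j \<in> {1..n} \<Longrightarrow> j \<noteq> q \<Longrightarrow> \<tau> (x j) = x j"
      by (metis (full_types))
    show ?thesis
    proof (rule finish)
      show "\<sigma> \<circ> \<tau> \<in> tame A n x" by (intro tame.comp tame.gen \<sigma>(1) \<tau>(1))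
      show "\<phi> ((\<sigma> \<circ> \<tau>) (x q)) - x q \<in> TL 2" using \<tau>(2) by (simp add: \<psi>_def)
      show "\<phi> ((\<sigma> \<circ> \<tau>) (x j)) \<in> TL 1" if "j \<in> {1..n}" "j \<noteq> q" for j
        using \<tau>(3)[OF that] \<psi>x[OF that(1)] by (simp add: \<psi>_def)
      show "\<phi> ((\<sigma> \<circ> \<tau>) (x j)) = \<phi> (x j)" if "j \<in> {1..n}" "q < j" for j
        using \<tau>(3) \<sigma>(3) that 2(2) by simp
    qed
  next
    case 3
    text \<open>Then \<open>x\<^sub>q\<close> is a combination of the other generators, so it is \<open>0\<close>: \<open>A\<close> is trivial.\<close>
    define y where "y = (\<Sum>i=1..n. d i \<cdot> x i)"
    have "\<phi> (inv \<phi> (x q) - y) \<in> TL 2"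
      using raisesD[OF raises_hom[OF hom\<phi> \<phi>(2)] bd] by (simp add: y_def)
    then have 1: "x q - \<phi> y \<in> TL 2" by (simp add: lin\<phi> Aut_inv_apply[OF \<phi>(1)])
    \<comment> \<open>The combination \<open>y\<close> involves only generators beyond q, on which
      \<phi> is already the identity up to higher terms.\<close>
    have "\<phi> y - y = (\<Sum>i=1..n. d i \<cdot> (\<phi> (x i) - x i))"
      by (simp add: y_def lin\<phi> vs.scale_right_diff_distrib sum_subtractf)
    moreover have "d i \<cdot> (\<phi> (x i) - x i) \<in> TL 2" if "i \<in> {1..n}" for i
      using 3[OF that] above[OF that] by (cases "i \<le> q") (auto intro: tail_scale tail_zero)
    ultimately have "\<phi> y - y \<in> TL 2" by (simp only: vs.subspace_sum[OF subspace_tail])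
    from tail_add[OF 1 this] have "x q - y \<in> TL (Suc 1)" by (simp add: numeral_2_eq_2)
    moreover have "x q - y \<in> HC 1"
      unfolding y_def by (intro hcomp_diff hcomp_sum hcomp_scale gen_in_hcomp q)
    ultimately have xq: "x q = y" using hcomp_tail_zero by fastforce
    \<comment> \<open>By freeness every generator other than x_q can be sent to 0; this turns x_q =
      y into x_q = 0.\<close>
    obtain h where h: "is_hom A A h" "\<And>i. i \<in> {1..n} \<Longrightarrow> h (x i) = (if i = q then x q else 0)"
      using ex_hom[of "\<lambda>i. if i = q then x q else 0"] by blast
    have "h y = (\<Sum>i=1..n. d i \<cdot> h (x i))" by (simp add: y_def linD[OF homD(1)[OF h(1)]])
    also have "\<dots> = 0" using 3[OF q] by (intro sum.neutral) (auto simp: h(2))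
    finally have "x q = 0" using h(2)[OF q] xq by simp
    then show ?thesis
      using \<phi>(2) by (intro finish[of id] tame.one) (auto simp: lin\<phi> tail_zero)
  qed
qed

text \<open>After the constants are removed, generators are normalized from x_n downwards;
  \<open>m\<close> counts those done, and \<open>n - m\<close> is the next pivot.\<close>

lemma tame_to_IA_1:
  assumes "\<phi> \<in> Aut A"
  shows "\<exists>\<tau>\<in>tame A n x. \<phi> \<circ> \<tau> \<in> IA A n x 1"
proof -
  have "\<exists>\<tau>\<in>tame A n x. (\<forall>j\<in>{1..n}. \<phi> (\<tau> (x j)) \<in> TL 1) \<and>
      (\<forall>j\<in>{1..n}. n - m < j \<longrightarrow> \<phi> (\<tau> (x j)) - x j \<in> TL 2)" for m
  proof (induction m)
    case 0
    then show ?case using tame_kills_constants[OF assms] by simp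
  next
    case (Suc m)
    then obtain \<tau> where \<tau>: "\<tau> \<in> tame A n x" "\<And>j. j \<in> {1..n} \<Longrightarrow> (\<phi> \<circ> \<tau>) (x j) \<in> TL 1"
      "\<And>j. j \<in> {1..n} \<Longrightarrow> n - m < j \<Longrightarrow> (\<phi> \<circ> \<tau>) (x j) - x j \<in> TL 2" by auto
    show ?case
    proof (cases "m < n")
      case True
      then have "n - m \<in> {1..n}" by simp
      from elimination[OF Aut_comp[OF assms tame_Aut[OF \<tau>(1)]] \<tau>(2) this \<tau>(3)]
      obtain \<sigma> where \<sigma>: "\<sigma> \<in> tame A n x" "\<And>j. j \<in> {1..n} \<Longrightarrow> (\<phi> \<circ> \<tau>) (\<sigma> (x j)) \<in> TL 1"
        "\<And>j. j \<in> {1..n} \<Longrightarrow> n - m \<le> j \<Longrightarrow> (\<phi> \<circ> \<tau>) (\<sigma> (x j)) - x j \<in> TL 2" by metis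
      then show ?thesis
        using tame.comp[OF \<tau>(1) \<sigma>(1)] True by (intro bexI[of _ "\<tau> \<circ> \<sigma>"]) auto
    next
      case False
      then show ?thesis using \<tau> by (intro bexI[of _ \<tau>]) auto
    qed
  qed
  from this[of n] obtain \<tau> where "\<tau> \<in> tame A n x"
    "\<And>j. j \<in> {1..n} \<Longrightarrow> \<phi> (\<tau> (x j)) - x j \<in> TL 2" by auto
  then show ?thesis
    using Aut_comp[OF assms tame_Aut] by (intro bexI[of _ \<tau>]) (auto simp: IA_def numeral_2_eq_2)
qed

section \<open>Degree-by-degree correction by tame automorphisms\<close>

lemma leading_part_in_tangent_algebra:
  assumes "\<phi> \<in> IA A n x k - IA A n x (k + 1)" "1 \<le> k"
    and "\<And>j. j \<in> {1..n} \<Longrightarrow> f j \<in> HC (k + 1)"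
    and "\<And>j. j \<in> {1..n} \<Longrightarrow> \<phi> (x j) - x j - f j \<in> TL (k + 2)"
  shows "vfield A n x f \<in> tangent_algebra A n x (Aut A)"
proof -
  have V: "vfield A n x f \<in> V A n x (Aut A) k"
    unfolding V_def
  proof (intro UnI2 CollectI exI conjI)
    show "\<phi> \<in> Aut A \<inter> IA A n x k - Aut A \<inter> IA A n x (k + 1)"
      using assms(1) by (auto simp: IA_def)
    show "\<forall>j\<in>{1..n}. \<phi> (x j) = x j + f j + (\<phi> (x j) - x j - f j) \<and>
        f j \<in> HC (k + 1) \<and> \<phi> (x j) - x j - f j \<in> TL (k + 2)"
      using assms(3,4) by simp
  qed (rule HOL.refl)
  define D where "D i = (if i = k then vfield A n x f else (\<lambda>a. 0))" for i
  have "vfield A n x f = (\<lambda>a. 0 + 0 + (\<Sum>i=1..k. D i a))"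
  proof
    fix a
    have "(\<Sum>i=1..k. D i a) = (\<Sum>i=1..k. if i = k then vfield A n x f a else 0)"
      by (rule sum.cong) (auto simp: D_def)
    then show "vfield A n x f a = 0 + 0 + (\<Sum>i=1..k. D i a)" using assms(2) by simp
  qed
  moreover have "\<forall>i\<in>{1..k}. D i \<in> V A n x (Aut A) i"
    using V by (auto simp: D_def) (simp add: V_def)
  moreover have "(\<lambda>a. 0) \<in> der_comp A n x (-1)" "(\<lambda>a. 0) \<in> der_comp A n x 0"
    using hdeg_0[of 0] hdeg_0[of 1] by (simp_all add: hdeg_iff_der_comp)
  ultimately show ?thesis
    unfolding tangent_algebra_def
    by (intro CollectI exI[of _ "\<lambda>a. 0"] exI[of _ D] exI[of _ k] conjI)
qed

lemma tame_correction:
  assumes \<phi>: "\<phi> \<in> IA A n x k" and k: "1 \<le> k" and "1 \<le> n"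
    and gen: "\<And>D. D \<in> tangent_algebra A n x (Aut A) \<Longrightarrow> graded_lie D"
  shows "\<exists>\<tau>\<in>tame A n x. \<phi> \<circ> \<tau> \<in> IA A n x (k + 1)"
\<comment> \<open>\<open>V\<close> records leading parts only of automorphisms outside the next
  \<open>IA\<close>; an automorphism inside it needs no correction.\<close>
proof (cases "\<phi> \<in> IA A n x (k + 1)")
  case True
  then show ?thesis by (intro bexI[of _ id] tame.one) simp
next
  case False
  have aut: "\<phi> \<in> Aut A" and t: "\<And>j. j \<in> {1..n} \<Longrightarrow> \<phi> (x j) - x j \<in> TL (k + 1)"
    using \<phi> by (auto simp: IA_def)
  define f where "f j = prj (k + 1) (\<phi> (x j) - x j)" for j
  define D where "D = vfield A n x f"
  have f: "f j \<in> HC (k + 1)" for j unfolding f_def by (rule prj_in_hcomp)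
  have F: "\<phi> (x j) - x j - f j \<in> TL (k + 2)" if "j \<in> {1..n}" for j
    unfolding tail_iff
  proof (intro allI impI)
    fix i assume "i < k + 2"
    then have "i < k + 1 \<or> i = k + 1" by auto
    then show "prj i (\<phi> (x j) - x j - f j) = 0"
      unfolding prj_lin(5)[of i "\<phi> (x j) - x j" "f j"]
      using t[OF that] prj_hcomp[OF f, of i j] by (auto simp: tail_iff f_def)
  qed
  have "graded_lie D"
    unfolding D_def
    by (rule gen, rule leading_part_in_tangent_algebra[of \<phi> k]) (use \<phi> False k f F in auto)
  then have "pos_lie (k + 1) (vfield A n x (\<lambda>j. prj (k + 1) (D (x j))))"
    using k by (intro graded_lie_component) simp_all
  moreover have "vfield A n x (\<lambda>j. prj (k + 1) (D (x j))) = D"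
    by (rule vfield_eqI) (simp_all add: D_def vfield_Der vfield_gen prj_hcomp[OF f, simplified])
  ultimately have "tame_tangent (k + 1) D"
    using pos_lie_tame_tangent[OF _ \<open>1 \<le> n\<close>] by simp
  then obtain \<tau> where \<tau>: "\<tau> \<in> tame A n x" "tangent (k + 1 - 1) \<tau> (\<lambda>a. (-1) \<cdot> D a)"
    by (rule tame_tangentD)
  have "tangent k \<phi> D"
    by (rule tangentI[OF AutD(1)[OF aut] _ k])
      (use hcomp_tail[OF f] F in \<open>simp_all add: D_def vfield_Der vfield_gen\<close>)
  from tangent_comp[OF k this] \<tau>(2) have "tangent k (\<phi> \<circ> \<tau>) (\<lambda>a. 0)"
    by fastforce
  \<comment> \<open>A vanishing leading part means that \<phi>\<tau> - 1 itself raises the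
    filtration by k+1, so it may serve as the next \<open>D\<close> with zero remainder.\<close>
  then have "tangent (k + 1) (\<phi> \<circ> \<tau>) (\<lambda>a. (\<phi> \<circ> \<tau>) a - a)"
    using raises_0 by (simp add: tangent_def)
  from tangent_IA[OF this Aut_comp[OF aut tame_Aut[OF \<tau>(1)]]] show ?thesis using \<tau>(1) by blast
qed

lemma tame_to_IA:
  assumes "\<phi> \<in> Aut A" "1 \<le> k" "1 \<le> n"
    and gen: "\<And>D. D \<in> tangent_algebra A n x (Aut A) \<Longrightarrow> graded_lie D"
  shows "\<exists>\<tau>\<in>tame A n x. \<phi> \<circ> \<tau> \<in> IA A n x k"
  using assms(2)
proof (induction k rule: dec_induct)
  case base
  show ?case by (rule tame_to_IA_1) fact
next
  case (step k)
  then obtain \<tau> where \<tau>: "\<tau> \<in> tame A n x" "\<phi> \<circ> \<tau> \<in> IA A n x k" by blast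
  from tame_correction[OF \<tau>(2) step.hyps(1) assms(3) gen] obtain \<sigma> where
    "\<sigma> \<in> tame A n x" "\<phi> \<circ> \<tau> \<circ> \<sigma> \<in> IA A n x (k + 1)" by blast
  then show ?case
    using tame.comp[OF \<tau>(1)] by (intro bexI[of _ "\<tau> \<circ> \<sigma>"]) (simp_all add: comp_def)
qed

end

theorem theorem3:
  fixes u :: bool and \<Sigma> :: "'k::field_char_0 nterm set"
    and A :: "('k, 'a::ab_group_add) nalg" and n :: nat and x :: "nat \<Rightarrow> 'a"
  assumes "n \<ge> 1"
    and "free_on u \<Sigma> A n x"
    and "lie_gen A
           (der_comp A n x (-1) \<union> der_comp A n x 0 \<union>
            {vfield A n x (\<lambda>j. if j = 1 then f else 0) | f d.
               d \<ge> 2 \<and> f \<in> hcomp A n x d \<and> f \<in> subalg A (x ` {2..n})})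
         = tangent_algebra A n x (Aut A)"
  shows "\<forall>\<phi>\<in>Aut A. approximately_tame A n x \<phi>"
proof
  interpret free_algebra u \<Sigma> A n x by unfold_locales fact
  fix \<phi> assume \<phi>: "\<phi> \<in> Aut A"
  have "\<exists>\<tau>\<in>tame A n x. \<phi> \<circ> \<tau> \<in> IA A n x k" if "1 \<le> k" for k
    by (rule tame_to_IA[OF \<phi> that assms(1)], rule lie_gen_graded_lie) (simp only: assms(3))
  then obtain \<tau> where \<tau>: "\<And>k. 1 \<le> k \<Longrightarrow> \<tau> k \<in> tame A n x"
    "\<And>k. 1 \<le> k \<Longrightarrow> \<phi> \<circ> \<tau> k \<in> IA A n x k" by metis
  \<comment> \<open>Approximate tameness composes with the inverse of the approximant, so the
    approximant is the inverse of the right correction.\<close>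
  have "inv (inv (\<tau> k)) = \<tau> k" if "1 \<le> k" for k
    by (intro inv_inv_eq AutD(2) tame_Aut \<tau>(1) that)
  then show "approximately_tame A n x \<phi>"
    unfolding approximately_tame_def
    by (intro exI[of _ "\<lambda>k. inv (\<tau> k)"]) (simp add: \<tau> tame.inverse)
qed

end
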